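(* Let $1<p<\infty$, let $X$ be a compact doubling $p$-Poincaré space and let $Y$ be a complete separable length space with a covering map $\phi:\widehat Y\to Y$ that is a local isometry. Suppose $h_1,h_2\in N^{1,p}(X;\widehat Y)$ are two lifts of a map $u\in N^{1,p}(X;Y)$. If $h_1$ agrees with $h_2$ on a set of positive $p$-capacity, then they agree $p$-quasieverywhere.
   Context: A compact doubling $p$-Poincaré space is a compact metric space $(X,d)$ with a Borel regular measure $\mu$, finite and nonzero on (nontrivial) balls, such that $\mu(B(x,2r))\le C\mu(B(x,r))$ for all balls, and which supports a weak $(1,p)$-Poincaré inequality: there are constants $C,\sigma\ge 1$ such that $\frac1{\mu(B)}\int_B|u-u_B|\,d\mu\le Cr\big(\frac1{\mu(\sigma B)}\int_{\sigma B}g^p\,d\mu\big)^{1/p}$ for every ball $B$ of radius $r$, every locally integrable $u:X\to\mathbb R$ and every locally integrable upper gradient $g$ of $u$; here $u_B$ is the mean of $u$ over $B$. Upper gradients: a Borel function $g:X\to[0,\infty]$ is an upper gradient of a map $u:X\to Z$ into a metric space if $d_Z(u(\gamma(0)),u(\gamma(1)))\le\int_\gamma g$ for every rectifiable curve $\gamma:[0,1]\to X$. Newtonian spaces: for a Banach space $V$, $N^{1,p}(X;V)$ consists of the $p$-integrable measurable maps $u:X\to V$ having an upper gradient in $L^p(\mu)$, two maps being identified if they agree $p$-quasieverywhere (outside a set of $p$-capacity zero), with $\|u\|_{1,p}^p=\|u\|_{L^p(X;V)}^p+\inf_g\|g\|_{L^p(\mu)}^p$. The $p$-capacity of $E\subset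 X$ is $\operatorname{Cap}_p(E)=\inf\|f\|_{1,p}^p$ over $f\in N^{1,p}(X;\mathbb R)$ with $f\ge1$ on $E$. For a separable metric space $Z$ with isometric Kuratowski embedding $Z\hookrightarrow\ell^\infty$, $N^{1,p}(X;Z)=\{u\in N^{1,p}(X;\ell^\infty):u(x)\in Z\text{ for }p\text{-quasievery }x\}$. Coverings and lifts: $\widehat Y$ is a connected length space with metric $\hat d$; $\phi$ is a local isometry if each $\hat y$ has a ball $B(\hat y,r)$ mapped isometrically onto $B(\phi(\hat y),r)$. A lift of $u\in N^{1,p}(X;Y)$ is a map $h\in N^{1,p}(X;\widehat Y)$ with $\phi\circ h=u$ as maps in $N^{1,p}(X;Y)$. *)

theory Defs
  imports "HOL-Analysis.Analysis"
begin

section \<open>Curves, upper gradients and length spaces\<close>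

definition curve_length :: "(real \<Rightarrow> 'a::metric_space) \<Rightarrow> real \<Rightarrow> real \<Rightarrow> ennreal" where
  "curve_length \<gamma> a b =
     (SUP (n, t) \<in> {(n, t). t 0 = a \<and> t n = b \<and> (\<forall>i<n. t i \<le> t (Suc i))}.
        \<Sum>i<(n::nat). ennreal (dist (\<gamma> (t i)) (\<gamma> (t (Suc i)))))"

definition rectifiable :: "(real \<Rightarrow> 'a::metric_space) \<Rightarrow> bool" where
  "rectifiable \<gamma> \<longleftrightarrow> path \<gamma> \<and> curve_length \<gamma> 0 1 < \<infinity>"

text \<open>The arc length parametrization of a rectifiable curve: the point reached after length \<open>s\<close>.
  It is unique, because a curve is constant on every interval on which its length vanishes.\<close>

definition arclength_param :: "(real \<Rightarrow> 'a::metric_space) \<Rightarrow> real \<Rightarrow> 'a" where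
  "arclength_param \<gamma> s = (THE x. \<exists>t\<in>{0..1}. curve_length \<gamma> 0 t = ennreal s \<and> x = \<gamma> t)"

definition line_integral :: "(real \<Rightarrow> 'a::metric_space) \<Rightarrow> ('a \<Rightarrow> ennreal) \<Rightarrow> ennreal" where
  "line_integral \<gamma> g =
     (\<integral>\<^sup>+ s\<in>{0..enn2real (curve_length \<gamma> 0 1)}. g (arclength_param \<gamma> s) \<partial>lborel)"

definition upper_gradient ::
  "('x::metric_space \<Rightarrow> ennreal) \<Rightarrow> ('x \<Rightarrow> 'z::metric_space) \<Rightarrow> bool" where
  "upper_gradient g u \<longleftrightarrow> g \<in> borel_measurable borel \<and>
     (\<forall>\<gamma>. rectifiable \<gamma> \<longrightarrow> ennreal (dist (u (\<gamma> 0)) (u (\<gamma> 1))) \<le> line_integral \<gamma> g)"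

definition length_space :: "'a::metric_space itself \<Rightarrow> bool" where
  "length_space _ \<longleftrightarrow> (\<forall>x y :: 'a. ennreal (dist x y) =
     (INF \<gamma> \<in> {\<gamma>. path \<gamma> \<and> pathstart \<gamma> = x \<and> pathfinish \<gamma> = y}. curve_length \<gamma> 0 1))"

definition local_isometry :: "('a::metric_space \<Rightarrow> 'b::metric_space) \<Rightarrow> bool" where
  "local_isometry \<phi> \<longleftrightarrow> (\<forall>z. \<exists>r>0. \<phi> ` ball z r = ball (\<phi> z) r \<and>
     (\<forall>a\<in>ball z r. \<forall>b\<in>ball z r. dist (\<phi> a) (\<phi> b) = dist a b))"

section \<open>Compact doubling Poincare spaces\<close>

text \<open>Powers with exponent \<open>q > 0\<close>, with \<open>\<infinity>\<close> raised to \<open>q\<close> being \<open>\<infinity>\<close>.\<close>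

definition epowr :: "ennreal \<Rightarrow> real \<Rightarrow> ennreal" where
  "epowr a q = (if a = \<infinity> then \<infinity> else ennreal (enn2real a powr q))"

text \<open>A Borel regular (outer) measure is given here by its restriction \<open>M\<close> to the Borel sets; as
  it is finite on the compact space, its measurable functions are those of \<open>completion M\<close>.\<close>

definition locally_integrable :: "'x::metric_space measure \<Rightarrow> ('x \<Rightarrow> real) \<Rightarrow> bool" where
  "locally_integrable M u \<longleftrightarrow> (\<forall>x. \<exists>r>0. set_integrable (completion M) (ball x r) u)"

definition mean_on :: "'x::metric_space measure \<Rightarrow> 'x set \<Rightarrow> ('x \<Rightarrow> real) \<Rightarrow> real" where
  "mean_on M B u = (LINT x:B|completion M. u x) / measure M B"

definition poincare_inequality :: "'x::metric_space measure \<Rightarrow> real \<Rightarrow> bool" where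
  "poincare_inequality M p \<longleftrightarrow> (\<exists>C\<ge>1. \<exists>\<sigma>\<ge>1. \<forall>x. \<forall>r>0. \<forall>u g.
     locally_integrable M u \<longrightarrow> upper_gradient g u \<longrightarrow>
     (\<forall>y. \<exists>s>0. (\<integral>\<^sup>+ w\<in>ball y s. g w \<partial>M) < \<infinity>) \<longrightarrow>
     (\<integral>\<^sup>+ y\<in>ball x r. ennreal \<bar>u y - mean_on M (ball x r) u\<bar> \<partial>completion M)
         / emeasure M (ball x r)
       \<le> ennreal (C * r) *
         epowr ((\<integral>\<^sup>+ y\<in>ball x (\<sigma> * r). epowr (g y) p \<partial>M) / emeasure M (ball x (\<sigma> * r))) (1 / p))"

definition compact_doubling_poincare_space :: "'x::metric_space measure \<Rightarrow> real \<Rightarrow> bool" where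
  "compact_doubling_poincare_space M p \<longleftrightarrow>
     compact (UNIV :: 'x set) \<and>
     sets M = sets borel \<and>
     (\<forall>x. \<forall>r>0. 0 < emeasure M (ball x r) \<and> emeasure M (ball x r) < \<infinity>) \<and>
     (\<exists>C. \<forall>x. \<forall>r>0. measure M (ball x (2 * r)) \<le> C * measure M (ball x r)) \<and>
     poincare_inequality M p"

section \<open>Newtonian spaces and capacity\<close>

text \<open>Elements of Newtonian spaces are handled through their representatives; equality of classes
  is equality quasieverywhere. Completeness of the target plays no role in the definition, which is
  used for the Banach spaces of real numbers and \<open>\<ell>\<^sup>\<infinity>\<close>.\<close>

definition newtonian ::
  "'x::metric_space measure \<Rightarrow> real \<Rightarrow> ('x \<Rightarrow> 'v::real_normed_vector) set" where
  "newtonian M p = {u. u \<in> borel_measurable (completion M) \<and>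
     (\<integral>\<^sup>+ x. ennreal (norm (u x) powr p) \<partial>completion M) < \<infinity> \<and>
     (\<exists>g. upper_gradient g u \<and> (\<integral>\<^sup>+ x. epowr (g x) p \<partial>M) < \<infinity>)}"

text \<open>The \<open>p\<close>-th power of the norm.\<close>

definition newtonian_norm_pow ::
  "'x::metric_space measure \<Rightarrow> real \<Rightarrow> ('x \<Rightarrow> 'v::real_normed_vector) \<Rightarrow> ennreal" where
  "newtonian_norm_pow M p u =
     (\<integral>\<^sup>+ x. ennreal (norm (u x) powr p) \<partial>completion M) +
     (INF g \<in> {g. upper_gradient g u}. \<integral>\<^sup>+ x. epowr (g x) p \<partial>M)"

definition capacity :: "'x::metric_space measure \<Rightarrow> real \<Rightarrow> 'x set \<Rightarrow> ennreal" where
  "capacity M p E =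
     (INF f \<in> {f \<in> newtonian M p. \<forall>x\<in>E. f x \<ge> (1::real)}. newtonian_norm_pow M p f)"

definition quasieverywhere ::
  "'x::metric_space measure \<Rightarrow> real \<Rightarrow> ('x \<Rightarrow> bool) \<Rightarrow> bool" where
  "quasieverywhere M p P \<longleftrightarrow> capacity M p {x. \<not> P x} = 0"

text \<open>Bounded continuous functions on the discrete space of natural numbers form \<open>\<ell>\<^sup>\<infinity>\<close>.\<close>

type_synonym linf = "(nat, real) bcontfun"

text \<open>The Kuratowski embedding determined by a dense sequence \<open>s\<close>.\<close>

definition kuratowski :: "(nat \<Rightarrow> 'z::metric_space) \<Rightarrow> 'z \<Rightarrow> linf" where
  "kuratowski s z = Bcontfun (\<lambda>n. dist z (s n) - dist (s 0) (s n))"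

text \<open>A class in \<open>N^{1,p}(X; Z)\<close>, i.e. a class of maps \<open>v\<close> into \<open>\<ell>\<^sup>\<infinity>\<close> with values
  quasieverywhere in the embedded copy of \<open>Z\<close>, is represented by a map \<open>u\<close> into \<open>Z\<close> itself, whose
  values on a set of capacity zero are irrelevant. The quantifier over \<open>s\<close> records that the notion
  is available only for separable \<open>Z\<close>; since \<open>M\<close> is finite in the application, the notion does not
  depend on the choice of \<open>s\<close>.\<close>

definition newtonian_into ::
  "'x::metric_space measure \<Rightarrow> real \<Rightarrow> ('x \<Rightarrow> 'z::metric_space) set" where
  "newtonian_into M p = {u. \<exists>s. closure (range s) = UNIV \<and>
     (\<exists>v \<in> newtonian M p. quasieverywhere M p (\<lambda>x. v x = kuratowski s (u x)))}"

definition is_lift ::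
  "'x::metric_space measure \<Rightarrow> real \<Rightarrow> ('z::metric_space \<Rightarrow> 'y::metric_space) \<Rightarrow>
   ('x \<Rightarrow> 'y) \<Rightarrow> ('x \<Rightarrow> 'z) \<Rightarrow> bool" where
  "is_lift M p \<phi> u h \<longleftrightarrow>
     h \<in> newtonian_into M p \<and> quasieverywhere M p (\<lambda>x. \<phi> (h x) = u x)"

end

theory Submission
  imports Defs "HOL-Probability.Distribution_Functions"
begin

text \<open>Along a curve outside a small exceptional family both lifts are continuous and lift the same
  path, so they agree either everywhere or nowhere on it. Hence, with \<open>A\<close> the set where the lifts
  agree, every positive multiple of one fixed \<open>p\<close>-integrable function, infinite along the
  exceptional curves, is an upper gradient of the indicator of \<open>A\<close>. The Poincare inequality on a
  ball that exhausts the space makes the indicator constant almost everywhere. As its Newtonian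
  norm then has no gradient part, \<open>A\<close> or its complement has not only measure but capacity zero.\<close>

section \<open>Arc length\<close>

text \<open>The hypotheses hold only quasieverywhere, and capacity is defined through functions
  rather than curves. No modulus of curve families is introduced: a family counts as small when one
  \<open>p\<close>-integrable Borel function has infinite line integral along each of its curves.
  Infinity survives multiplication by any \<epsilon> > 0, so the energy of the upper gradient can
  tend to 0 while the bad curves stay harmless. Constant curves escape this device, since all their
  line integrals are 0, but their endpoints coincide; hence the recurring assumption of positive
  length. Continuity of a lift along a good curve comes from the absolute continuity of an integral
  over arc length, which is why continuity of arc length and of its parametrization is established.
  A second obstacle is measurability: the lifts are arbitrary representatives, known only through
  Kuratowski embeddings that may use different dense sequences. Measurability of the agreement set
  is therefore derived from distances to points, and for the completed measure.\<close>

definition polygon_length :: "(real \<Rightarrow> 'a::metric_space) \<Rightarrow> nat \<Rightarrow> (nat \<Rightarrow> real) \<Rightarrow> real" where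
  "polygon_length \<gamma> n t = (\<Sum>i<n. dist (\<gamma> (t i)) (\<gamma> (t (Suc i))))"

lemma polygon_length_nonneg [simp]: "0 \<le> polygon_length \<gamma> n t"
  by (simp add: polygon_length_def sum_nonneg)

lemma polygon_length_ennreal:
  "(\<Sum>i<n. ennreal (dist (\<gamma> (t i)) (\<gamma> (t (Suc i))))) = ennreal (polygon_length \<gamma> n t)"
  by (simp add: polygon_length_def)

lemma polygon_length_le_curve_length:
  assumes "t 0 = a" "t n = b" "\<And>i. i < n \<Longrightarrow> t i \<le> t (Suc i)"
  shows "ennreal (polygon_length \<gamma> n t) \<le> curve_length \<gamma> a b"
  unfolding curve_length_def
  by (rule SUP_upper2[of "(n, t)"]) (use assms in \<open>auto simp: polygon_length_def\<close>)

lemma curve_length_least: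
  assumes "\<And>n t. \<lbrakk>t 0 = a; t n = b; \<And>i. i < n \<Longrightarrow> t i \<le> t (Suc i)\<rbrakk> \<Longrightarrow> ennreal (polygon_length \<gamma> n t) \<le> c"
  shows "curve_length \<gamma> a b \<le> c"
  unfolding curve_length_def
  by (rule SUP_least) (use assms in \<open>auto simp: polygon_length_def\<close>)

lemma less_curve_lengthE:
  assumes "c < curve_length \<gamma> a b"
  obtains n t where "t 0 = a" "t n = b" "\<And>i. i < n \<Longrightarrow> t i \<le> t (Suc i)"
    "c < ennreal (polygon_length \<gamma> n t)"
proof -
  have "\<not> (\<forall>n t. t 0 = a \<longrightarrow> t n = b \<longrightarrow> (\<forall>i<n. t i \<le> t (Suc i)) \<longrightarrow> ennreal (polygon_length \<gamma> n t) \<le> c)"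
    using assms curve_length_least[of a b \<gamma> c] by (auto simp: not_less[symmetric])
  then show ?thesis
    using that by (auto simp: not_le)
qed

lemma dist_le_curve_length:
  assumes "a \<le> b"
  shows "ennreal (dist (\<gamma> a) (\<gamma> b)) \<le> curve_length \<gamma> a b"
  using polygon_length_le_curve_length[of "\<lambda>i. if i = 0 then a else b" a 1 b \<gamma>] assms
  by (simp add: polygon_length_def)

lemma partition_mono:
  fixes t :: "nat \<Rightarrow> real"
  assumes "\<And>i. i < n \<Longrightarrow> t i \<le> t (Suc i)" "i \<le> j" "j \<le> n"
  shows "t i \<le> t j"
  using assms(2,3)
proof (induction j rule: dec_induct)
  case (step k)
  then show ?case using assms(1)[of k] by force
qed simp

text \<open>Clipping a partition at \<open>b\<close> from above and from below gives partitions of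
  the two halves with the same index range, so the comparison is termwise. The triangle inequality
  is used only on the edge that straddles \<open>b\<close>.\<close>

lemma curve_length_split_le:
  assumes "a \<le> b" "b \<le> c"
  shows "curve_length \<gamma> a c \<le> curve_length \<gamma> a b + curve_length \<gamma> b c"
proof (rule curve_length_least)
  fix n t assume t: "t 0 = a" "t n = c" "\<And>i. i < n \<Longrightarrow> t i \<le> t (Suc i)"
  have "polygon_length \<gamma> n t \<le> polygon_length \<gamma> n (\<lambda>i. min (t i) b) + polygon_length \<gamma> n (\<lambda>i. max (t i) b)"
    unfolding polygon_length_def sum.distrib[symmetric]
  proof (rule sum_mono)
    fix i assume "i \<in> {..<n}"
    then have "t i \<le> t (Suc i)" using t by auto
    then consider "t (Suc i) \<le> b" | "b \<le> t i" | "t i \<le> b" "b \<le> t (Suc i)" by linarith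
    then show "dist (\<gamma> (t i)) (\<gamma> (t (Suc i))) \<le>
        dist (\<gamma> (min (t i) b)) (\<gamma> (min (t (Suc i)) b)) + dist (\<gamma> (max (t i) b)) (\<gamma> (max (t (Suc i)) b))"
      using \<open>t i \<le> t (Suc i)\<close> by cases (auto simp: min_absorb1 min_absorb2 max_absorb1 max_absorb2 dist_triangle)
  qed
  then have "ennreal (polygon_length \<gamma> n t) \<le> ennreal (polygon_length \<gamma> n (\<lambda>i. min (t i) b)) + ennreal (polygon_length \<gamma> n (\<lambda>i. max (t i) b))"
    by (subst ennreal_plus[symmetric]) (simp_all add: ennreal_leI del: ennreal_plus)
  also have "\<dots> \<le> curve_length \<gamma> a b + curve_length \<gamma> b c"
  proof (intro add_mono polygon_length_le_curve_length)
    show "min (t i) b \<le> min (t (Suc i)) b" "max (t i) b \<le> max (t (Suc i)) b" if "i < n" for i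
      by (intro min.mono max.mono t(3)[OF that] order_refl)+
  qed (use t(1,2) assms in auto)
  finally show "ennreal (polygon_length \<gamma> n t) \<le> curve_length \<gamma> a b + curve_length \<gamma> b c" .
qed

text \<open>The two partitions share the point \<open>b\<close>, so the second is glued on at index
  \<open>n\<close> and its own index 0 adds no edge.\<close>

lemma polygon_length_append:
  assumes t: "t 0 = a" "t n = b" "\<And>i. i < n \<Longrightarrow> t i \<le> t (Suc i)"
    and s: "s 0 = b" "s m = c" "\<And>i. i < m \<Longrightarrow> s i \<le> s (Suc i)"
  shows "ennreal (polygon_length \<gamma> n t) + ennreal (polygon_length \<gamma> m s) \<le> curve_length \<gamma> a c"
proof -
  define u where "u = (\<lambda>i. if i \<le> n then t i else s (i - n))"
  have u_t: "u i = t i" if "i \<le> n" for i using that by (simp add: u_def)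
  have u_s: "u (n + i) = s i" for i using t s by (simp add: u_def)
  have "polygon_length \<gamma> (n + m) u = polygon_length \<gamma> n t + polygon_length \<gamma> m s"
  proof -
    have "polygon_length \<gamma> (n + m) u
        = (\<Sum>i<n. dist (\<gamma> (u i)) (\<gamma> (u (Suc i)))) + (\<Sum>i<m. dist (\<gamma> (u (n + i))) (\<gamma> (u (n + Suc i))))"
      unfolding polygon_length_def by (induction m) (auto simp: algebra_simps)
    then show ?thesis
      unfolding u_s by (simp add: polygon_length_def u_t)
  qed
  moreover have "ennreal (polygon_length \<gamma> (n + m) u) \<le> curve_length \<gamma> a c"
  proof (rule polygon_length_le_curve_length)
    show "u 0 = a" "u (n + m) = c" using t s u_s by (auto simp: u_t)
    show "u i \<le> u (Suc i)" if "i < n + m" for i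
    proof (cases "i < n")
      case True then show ?thesis using t by (simp add: u_t)
    next
      case False
      then obtain j where "i = n + j" using le_Suc_ex not_less by blast
      then show ?thesis using that s(3)[of j] u_s[of j] u_s[of "Suc j"] by simp
    qed
  qed
  ultimately show ?thesis
    by (subst ennreal_plus[symmetric]) (simp_all del: ennreal_plus)
qed

text \<open>Concatenated partitions are bounded one supremum at a time. Moving a summand into a
  supremum requires a nonempty index set, which is where the order of the endpoints enters.\<close>

lemma curve_length_split_ge:
  assumes "a \<le> b" "b \<le> c"
  shows "curve_length \<gamma> a b + curve_length \<gamma> b c \<le> curve_length \<gamma> a c"
proof -
  let ?I = "\<lambda>a b. {(n, t). t 0 = a \<and> t n = b \<and> (\<forall>i<n::nat. t i \<le> t (Suc i))}"
  have ne: "?I a b \<noteq> {}" if "a \<le> b" for a b :: real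
    using that by (auto intro!: exI[of _ 1] exI[of _ "\<lambda>i. if i = 0 then a else b"])
  have eq: "curve_length \<gamma> a b = (SUP (n, t) \<in> ?I a b. ennreal (polygon_length \<gamma> n t))" for a b
    unfolding curve_length_def by (simp add: polygon_length_ennreal)
  have "ennreal (polygon_length \<gamma> n t) + curve_length \<gamma> b c \<le> curve_length \<gamma> a c"
    if "t 0 = a" "t n = b" "\<forall>i<n. t i \<le> t (Suc i)" for n t
    unfolding eq[of b c]
    by (subst ennreal_SUP_add_right[OF ne[OF assms(2)]])
      (use that in \<open>auto intro!: SUP_least polygon_length_append simp: case_prod_beta\<close>)
  then show ?thesis
    unfolding eq[of a b]
    by (subst ennreal_SUP_add_left[OF ne[OF assms(1)], symmetric])
      (auto intro!: SUP_least simp: case_prod_beta)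
qed

lemma curve_length_split:
  "a \<le> b \<Longrightarrow> b \<le> c \<Longrightarrow> curve_length \<gamma> a c = curve_length \<gamma> a b + curve_length \<gamma> b c"
  by (intro antisym curve_length_split_le curve_length_split_ge)

lemma curve_length_compose_mono_le:
  assumes "mono f"
  shows "curve_length (\<gamma> \<circ> f) a b \<le> curve_length \<gamma> (f a) (f b)"
proof (rule curve_length_least)
  fix n t assume t: "t 0 = a" "t n = b" "\<And>i. i < n \<Longrightarrow> t i \<le> t (Suc i)"
  have "ennreal (polygon_length \<gamma> n (f \<circ> t)) \<le> curve_length \<gamma> (f a) (f b)"
    by (rule polygon_length_le_curve_length) (use t assms in \<open>auto intro: monoD\<close>)
  then show "ennreal (polygon_length (\<gamma> \<circ> f) n t) \<le> curve_length \<gamma> (f a) (f b)"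
    by (simp add: polygon_length_def)
qed

text \<open>Monotone reparametrization never increases length; applying this to the affine map and
  to its inverse gives equality.\<close>

lemma curve_length_affine:
  assumes "u < v"
  shows "curve_length (\<lambda>x. \<gamma> (u + (v - u) * x)) a b = curve_length \<gamma> (u + (v - u) * a) (u + (v - u) * b)"
proof (rule antisym)
  define f where "f = (\<lambda>x. u + (v - u) * x)"
  define g where "g = (\<lambda>x. (x - u) / (v - u))"
  have fg: "f (g x) = x" "g (f x) = x" for x
    using assms by (auto simp: f_def g_def)
  have "mono f" "mono g"
    using assms by (auto simp: f_def g_def mono_def divide_right_mono mult_left_mono)
  have "curve_length ((\<gamma> \<circ> f) \<circ> g) (f a) (f b) \<le> curve_length (\<gamma> \<circ> f) a b"
    using curve_length_compose_mono_le[OF \<open>mono g\<close>, of "\<gamma> \<circ> f" "f a" "f b"] by (simp add: fg)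
  moreover have "(\<gamma> \<circ> f) \<circ> g = \<gamma>" by (auto simp: fg)
  ultimately show "curve_length \<gamma> (u + (v - u) * a) (u + (v - u) * b) \<le> curve_length (\<lambda>x. \<gamma> (u + (v - u) * x)) a b"
    by (simp add: f_def o_def)
  show "curve_length (\<lambda>x. \<gamma> (u + (v - u) * x)) a b \<le> curve_length \<gamma> (u + (v - u) * a) (u + (v - u) * b)"
    using curve_length_compose_mono_le[OF \<open>mono f\<close>, of \<gamma> a b] by (simp add: f_def o_def)
qed

section \<open>Lower semicontinuity of length in its endpoints\<close>

lemma continuous_polygon_length:
  assumes "continuous_on {0..1} \<gamma>" "\<And>i. i \<le> n \<Longrightarrow> continuous_on {0..1} (\<lambda>r. q r i)"
    and "\<And>r i. r \<in> {0..1} \<Longrightarrow> i \<le> n \<Longrightarrow> q r i \<in> {0..1}"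
  shows "continuous_on {0..1} (\<lambda>r. polygon_length \<gamma> n (q r))"
  unfolding polygon_length_def
  by (intro continuous_intros continuous_on_compose2[OF assms(1)] assms(2)) (use assms(3) in force)+

text \<open>One partition whose polygon beats \<open>c\<close> serves all nearby \<open>r\<close>
  once its points are clipped at \<open>r\<close>: the clipped polygon length is continuous in
  \<open>r\<close> and unchanged at \<open>r = t\<close>.\<close>

lemma curve_length_lsc_left:
  assumes \<gamma>: "path \<gamma>" and t: "t \<in> {0..1}" and c: "c < curve_length \<gamma> 0 t"
  shows "\<forall>\<^sub>F r in at t within {0..1}. c < curve_length \<gamma> 0 r"
proof -
  obtain n s where s: "s 0 = 0" "s n = t" "\<And>i. i < n \<Longrightarrow> s i \<le> s (Suc i)"
    and c': "c < ennreal (polygon_length \<gamma> n s)"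
    using less_curve_lengthE[OF c] by metis
  define q where "q r i = min (s i) r" for r i
  have s_range: "0 \<le> s i" "s i \<le> t" if "i \<le> n" for i
    using partition_mono[of n s 0 i] partition_mono[of n s i n] s that by auto
  have "continuous_on {0..1} (\<lambda>r. polygon_length \<gamma> n (q r))"
  proof (rule continuous_polygon_length)
    show "continuous_on {0..1} \<gamma>" using \<gamma> by (simp add: path_def)
    show "continuous_on {0..1} (\<lambda>r. q r i)" for i
      unfolding q_def by (intro continuous_intros)
    show "q r i \<in> {0..1}" if "r \<in> {0..1}" "i \<le> n" for r i
      using that s_range[of i] t by (auto simp: q_def)
  qed
  then have lim: "((\<lambda>r. ennreal (polygon_length \<gamma> n (q r))) \<longlongrightarrow> ennreal (polygon_length \<gamma> n (q t))) (at t within {0..1})"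
    using t by (intro tendsto_ennrealI) (auto simp: continuous_on_def)
  have "polygon_length \<gamma> n (q t) = polygon_length \<gamma> n s"
    unfolding polygon_length_def q_def using s_range by (intro sum.cong) (auto simp: min_absorb1)
  with c' have "\<forall>\<^sub>F r in at t within {0..1}. c < ennreal (polygon_length \<gamma> n (q r))"
    by (intro order_tendstoD(1)[OF lim]) simp
  moreover have "\<forall>\<^sub>F r in at t within {0..1}. r \<in> {0..1}"
    by (simp add: eventually_at_filter)
  ultimately show ?thesis
  proof eventually_elim
    case (elim r)
    \<comment> \<open>Clipping changes nothing for \<open>r\<close> beyond \<open>t\<close>, so the
      polygon ends at the smaller of the two; this treats both sides of \<open>t\<close> at
      once.\<close>
    have "ennreal (polygon_length \<gamma> n (q r)) \<le> curve_length \<gamma> 0 (min t r)"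
    proof (rule polygon_length_le_curve_length)
      show "q r i \<le> q r (Suc i)" if "i < n" for i
        unfolding q_def by (intro min.mono s(3)[OF that] order_refl)
    qed (use s elim in \<open>auto simp: q_def\<close>)
    also have "\<dots> \<le> curve_length \<gamma> 0 r"
      using curve_length_split[of 0 "min t r" r \<gamma>] elim t by auto
    finally show ?case using elim by auto
  qed
qed

lemma curve_length_lsc_right:
  assumes \<gamma>: "path \<gamma>" and t: "t \<in> {0..1}" and c: "c < curve_length \<gamma> t 1"
  shows "\<forall>\<^sub>F r in at t within {0..1}. c < curve_length \<gamma> r 1"
proof -
  obtain n s where s: "s 0 = t" "s n = 1" "\<And>i. i < n \<Longrightarrow> s i \<le> s (Suc i)"
    and c': "c < ennreal (polygon_length \<gamma> n s)"
    using less_curve_lengthE[OF c] by metis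
  define q where "q r i = max (s i) r" for r i
  have s_range: "t \<le> s i" "s i \<le> 1" if "i \<le> n" for i
    using partition_mono[of n s 0 i] partition_mono[of n s i n] s that by auto
  have "continuous_on {0..1} (\<lambda>r. polygon_length \<gamma> n (q r))"
  proof (rule continuous_polygon_length)
    show "continuous_on {0..1} \<gamma>" using \<gamma> by (simp add: path_def)
    show "continuous_on {0..1} (\<lambda>r. q r i)" for i
      unfolding q_def by (intro continuous_intros)
    show "q r i \<in> {0..1}" if "r \<in> {0..1}" "i \<le> n" for r i
      using that s_range[of i] t by (auto simp: q_def)
  qed
  then have lim: "((\<lambda>r. ennreal (polygon_length \<gamma> n (q r))) \<longlongrightarrow> ennreal (polygon_length \<gamma> n (q t))) (at t within {0..1})"
    using t by (intro tendsto_ennrealI) (auto simp: continuous_on_def)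
  have "polygon_length \<gamma> n (q t) = polygon_length \<gamma> n s"
    unfolding polygon_length_def q_def using s_range by (intro sum.cong) (auto simp: max_absorb1)
  with c' have "\<forall>\<^sub>F r in at t within {0..1}. c < ennreal (polygon_length \<gamma> n (q r))"
    by (intro order_tendstoD(1)[OF lim]) simp
  moreover have "\<forall>\<^sub>F r in at t within {0..1}. r \<in> {0..1}"
    by (simp add: eventually_at_filter)
  ultimately show ?thesis
  proof eventually_elim
    case (elim r)
    have "ennreal (polygon_length \<gamma> n (q r)) \<le> curve_length \<gamma> (max t r) 1"
    proof (rule polygon_length_le_curve_length)
      show "q r i \<le> q r (Suc i)" if "i < n" for i
        unfolding q_def by (intro max.mono s(3)[OF that] order_refl)
    qed (use s elim in \<open>auto simp: q_def\<close>)
    also have "\<dots> \<le> curve_length \<gamma> r 1"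
      using curve_length_split[of r "max t r" 1 \<gamma>] elim t by auto
    finally show ?case using elim by auto
  qed
qed

lemma line_integral_mono: "(\<And>x. g x \<le> g' x) \<Longrightarrow> line_integral \<gamma> g \<le> line_integral \<gamma> g'"
  unfolding line_integral_def by (intro nn_integral_mono mult_right_mono) auto

text \<open>Real-valued, so that differences and continuity make sense. Since
  \<open>enn2real\<close> sends infinity to 0, the value is meaningful only along rectifiable
  curves.\<close>

definition arc_length :: "(real \<Rightarrow> 'a::metric_space) \<Rightarrow> real \<Rightarrow> real" where
  "arc_length \<gamma> t = enn2real (curve_length \<gamma> 0 t)"

section \<open>Arc length function and parametrization of a rectifiable curve\<close>

context
  fixes \<gamma> :: "real \<Rightarrow> 'a::metric_space"
  assumes rect: "rectifiable \<gamma>"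
begin

lemma curve_length_finite:
  assumes "0 \<le> a" "a \<le> b" "b \<le> 1"
  shows "curve_length \<gamma> a b < \<infinity>"
proof -
  have "curve_length \<gamma> 0 1 < \<infinity>" using rect by (simp add: rectifiable_def)
  then show ?thesis
    using curve_length_split[of 0 a 1 \<gamma>] curve_length_split[of a b 1 \<gamma>] assms by auto
qed

lemma curve_length_eq_arc_length:
  assumes "0 \<le> a" "a \<le> b" "b \<le> 1"
  shows "curve_length \<gamma> a b = ennreal (arc_length \<gamma> b - arc_length \<gamma> a)"
proof -
  have fin: "curve_length \<gamma> 0 a < top" "curve_length \<gamma> a b < top"
    using curve_length_finite[of 0 a] curve_length_finite[of a b] assms by auto
  have "curve_length \<gamma> 0 b = curve_length \<gamma> 0 a + curve_length \<gamma> a b"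
    using assms by (intro curve_length_split) auto
  then have "arc_length \<gamma> b = arc_length \<gamma> a + enn2real (curve_length \<gamma> a b)"
    using fin by (simp add: arc_length_def enn2real_plus)
  then show ?thesis using fin by simp
qed

lemma arc_length_mono:
  assumes "0 \<le> a" "a \<le> b" "b \<le> 1"
  shows "arc_length \<gamma> a \<le> arc_length \<gamma> b"
proof -
  have fin: "curve_length \<gamma> 0 b < top"
    using curve_length_finite[of 0 b] assms by auto
  have "curve_length \<gamma> 0 b = curve_length \<gamma> 0 a + curve_length \<gamma> a b"
    using assms by (intro curve_length_split) auto
  then show ?thesis
    unfolding arc_length_def using fin by (intro enn2real_mono) auto
qed

lemma arc_length_0 [simp]: "arc_length \<gamma> 0 = 0"
proof -
  have "curve_length \<gamma> 0 0 + curve_length \<gamma> 0 0 = curve_length \<gamma> 0 0"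
    using curve_length_split[of 0 0 0 \<gamma>] by simp
  moreover have "curve_length \<gamma> 0 0 < \<infinity>" by (rule curve_length_finite) auto
  ultimately have "curve_length \<gamma> 0 0 = 0"
    by (metis add.right_neutral ennreal_add_left_cancel infinity_ennreal_def less_irrefl)
  then show ?thesis by (simp add: arc_length_def)
qed

lemma arc_length_range: "t \<in> {0..1} \<Longrightarrow> arc_length \<gamma> t \<in> {0..arc_length \<gamma> 1}"
  using arc_length_mono[of 0 t] arc_length_mono[of t 1] by auto

lemma dist_le_arc_length:
  assumes "0 \<le> a" "a \<le> b" "b \<le> 1"
  shows "dist (\<gamma> a) (\<gamma> b) \<le> arc_length \<gamma> b - arc_length \<gamma> a"
  using dist_le_curve_length[of a b \<gamma>] curve_length_eq_arc_length[OF assms] arc_length_mono[OF assms] assms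
  by (simp add: ennreal_le_iff)

text \<open>Both the length up to \<open>t\<close> and the length after \<open>t\<close> are suprema of functions continuous
  in \<open>t\<close>, hence lower semicontinuous, and they have a constant finite sum.\<close>

lemma continuous_on_arc_length: "continuous_on {0..1} (arc_length \<gamma>)"
  unfolding continuous_on_def
proof (intro ballI order_tendstoI)
  fix t :: real and c :: real
  assume t: "t \<in> {0..1}"
  have path: "path \<gamma>" using rect by (simp add: rectifiable_def)
  have ev: "\<forall>\<^sub>F r in at t within {0..1}. r \<in> {0..1}"
    by (simp add: eventually_at_filter)
  {
    assume c: "c < arc_length \<gamma> t"
    show "\<forall>\<^sub>F r in at t within {0..1}. c < arc_length \<gamma> r"
    proof (cases "c < 0")
      case True
      show ?thesis using ev by eventually_elim (use True arc_length_range in fastforce)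
    next
      case False
      have "ennreal c < curve_length \<gamma> 0 t"
        using c False t curve_length_eq_arc_length[of 0 t] by (simp add: ennreal_less_iff)
      from curve_length_lsc_left[OF path t this] ev show ?thesis
      proof eventually_elim
        case (elim r)
        then show ?case using False curve_length_eq_arc_length[of 0 r] by (simp add: ennreal_less_iff)
      qed
    qed
  next
    assume c: "arc_length \<gamma> t < c"
    show "\<forall>\<^sub>F r in at t within {0..1}. arc_length \<gamma> r < c"
    proof (cases "c > arc_length \<gamma> 1")
      case True
      show ?thesis using ev by eventually_elim (use True arc_length_range in fastforce)
    next
      case False
      have "ennreal (arc_length \<gamma> 1 - c) < curve_length \<gamma> t 1"
        using c False t curve_length_eq_arc_length[of t 1] by (simp add: ennreal_less_iff)
      from curve_length_lsc_right[OF path t this] ev show ?thesis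
      proof eventually_elim
        case (elim r)
        then show ?case using False curve_length_eq_arc_length[of r 1] by (simp add: ennreal_less_iff)
      qed
    qed
  }
qed

lemma arc_length_surj:
  assumes "0 \<le> a" "a \<le> b" "b \<le> 1" "arc_length \<gamma> a \<le> s" "s \<le> arc_length \<gamma> b"
  obtains t where "a \<le> t" "t \<le> b" "arc_length \<gamma> t = s"
  using IVT'[of "arc_length \<gamma>" a s b] assms continuous_on_subset[OF continuous_on_arc_length, of "{a..b}"]
  by auto

lemma arclength_param_arc_length:
  assumes "t \<in> {0..1}"
  shows "arclength_param \<gamma> (arc_length \<gamma> t) = \<gamma> t"
  unfolding arclength_param_def
proof (rule the_equality)
  show "\<exists>r\<in>{0..1}. curve_length \<gamma> 0 r = ennreal (arc_length \<gamma> t) \<and> \<gamma> t = \<gamma> r"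
    using assms curve_length_eq_arc_length[of 0 t] by auto
  fix x assume "\<exists>r\<in>{0..1}. curve_length \<gamma> 0 r = ennreal (arc_length \<gamma> t) \<and> x = \<gamma> r"
  then obtain r where r: "r \<in> {0..1}" "arc_length \<gamma> r = arc_length \<gamma> t" "x = \<gamma> r"
    using assms arc_length_range[of t] by (auto simp: arc_length_def)
  have "dist (\<gamma> r) (\<gamma> t) \<le> 0"
  proof (cases "r \<le> t")
    case True
    then show ?thesis using dist_le_arc_length[of r t] r assms by auto
  next
    case False
    then show ?thesis using dist_le_arc_length[of t r] r assms by (auto simp: dist_commute)
  qed
  then show "x = \<gamma> t" using r by simp
qed

lemma arclength_param_lipschitz:
  assumes "s \<in> {0..arc_length \<gamma> 1}" "s' \<in> {0..arc_length \<gamma> 1}"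
  shows "dist (arclength_param \<gamma> s) (arclength_param \<gamma> s') \<le> \<bar>s - s'\<bar>"
proof -
  obtain t t' where t: "t \<in> {0..1}" "arc_length \<gamma> t = s" "t' \<in> {0..1}" "arc_length \<gamma> t' = s'"
    using arc_length_surj[of 0 1 s] arc_length_surj[of 0 1 s'] assms by (metis arc_length_0 atLeastAtMost_iff order_refl zero_le_one)
  have "dist (\<gamma> t) (\<gamma> t') \<le> \<bar>arc_length \<gamma> t - arc_length \<gamma> t'\<bar>"
  proof (cases "t \<le> t'")
    case True
    then show ?thesis using dist_le_arc_length[of t t'] t by auto
  next
    case False
    then show ?thesis using dist_le_arc_length[of t' t] t by (auto simp: dist_commute)
  qed
  then show ?thesis using arclength_param_arc_length t by auto
qed

text \<open>The clamping makes the arc length parametrization continuous on the whole line.\<close>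

definition clamped_param :: "real \<Rightarrow> 'a" where
  "clamped_param s = arclength_param \<gamma> (max 0 (min (arc_length \<gamma> 1) s))"

lemma clamped_param_arc_length:
  assumes "t \<in> {0..1}"
  shows "clamped_param (arc_length \<gamma> t) = \<gamma> t"
  using arclength_param_arc_length[OF assms] arc_length_range[OF assms] by (simp add: clamped_param_def)

lemma clamped_param_in_image: "clamped_param s \<in> \<gamma> ` {0..1}"
proof -
  have "0 \<le> arc_length \<gamma> 1" using arc_length_range[of 1] by auto
  then obtain t where "0 \<le> t" "t \<le> 1" "arc_length \<gamma> t = max 0 (min (arc_length \<gamma> 1) s)"
    using arc_length_surj[of 0 1 "max 0 (min (arc_length \<gamma> 1) s)"] by auto
  then show ?thesis
    using arclength_param_arc_length[of t] by (force simp: clamped_param_def)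
qed

lemma continuous_on_clamped_param: "continuous_on UNIV clamped_param"
proof -
  have "1-lipschitz_on UNIV clamped_param"
  proof (rule lipschitz_onI)
    fix s s'
    let ?c = "\<lambda>s. max 0 (min (arc_length \<gamma> 1) s)"
    have "0 \<le> arc_length \<gamma> 1" using arc_length_range[of 1] by auto
    then have "dist (clamped_param s) (clamped_param s') \<le> \<bar>?c s - ?c s'\<bar>"
      unfolding clamped_param_def by (intro arclength_param_lipschitz) auto
    also have "\<dots> \<le> 1 * dist s s'" by (simp add: dist_real_def)
    finally show "dist (clamped_param s) (clamped_param s') \<le> 1 * dist s s'" .
  qed simp
  then show ?thesis by (rule lipschitz_on_continuous_on)
qed

lemma measurable_clamped_param [measurable]: "clamped_param \<in> borel_measurable borel"
  by (rule borel_measurable_continuous_onI[OF continuous_on_clamped_param])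

section \<open>Line integrals\<close>

text \<open>Clamping has no effect on the interval of integration, and it makes the integrand Borel
  on the whole line whenever \<open>g\<close> is.\<close>

lemma line_integral_clamped_param:
  "line_integral \<gamma> g = (\<integral>\<^sup>+ s\<in>{0..arc_length \<gamma> 1}. g (clamped_param s) \<partial>lborel)"
  unfolding line_integral_def arc_length_def[symmetric]
  by (intro nn_integral_cong) (auto simp: clamped_param_def split: split_indicator)

lemma rectifiable_restrict:
  assumes "0 \<le> u" "u < v" "v \<le> 1"
  shows "rectifiable (\<lambda>x. \<gamma> (u + (v - u) * x))"
proof -
  have sub: "u + (v - u) * x \<in> {0..1}" if "x \<in> {0..1}" for x
  proof -
    have "(v - u) * x \<le> v - u" using assms that by (intro mult_left_le) auto
    moreover have "0 \<le> (v - u) * x" using assms that by simp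
    ultimately show ?thesis unfolding atLeastAtMost_iff using assms by linarith
  qed
  have "continuous_on {0..1} \<gamma>" using rect by (simp add: rectifiable_def path_def)
  then have "path (\<lambda>x. \<gamma> (u + (v - u) * x))"
    unfolding path_def
    by (rule continuous_on_compose2) (use sub in \<open>auto intro!: continuous_intros\<close>)
  then show ?thesis
    using curve_length_finite[of u v] curve_length_affine[OF assms(2), of \<gamma> 0 1] assms
    by (simp add: rectifiable_def)
qed

text \<open>Lengths along the subcurve are those along \<gamma> minus
  \<open>arc_length \<gamma> u\<close>, so its arc length parametrization is a translate of that of
  \<gamma>, and the integral changes by a translation of the variable.\<close>

lemma line_integral_restrict:
  assumes "0 \<le> u" "u < v" "v \<le> 1" and [measurable]: "g \<in> borel_measurable borel"
  shows "line_integral (\<lambda>x. \<gamma> (u + (v - u) * x)) g =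
    (\<integral>\<^sup>+ s\<in>{arc_length \<gamma> u..arc_length \<gamma> v}. g (clamped_param s) \<partial>lborel)"
proof -
  let ?\<beta> = "\<lambda>x. \<gamma> (u + (v - u) * x)"
  have sub: "u \<le> u + (v - u) * x" "u + (v - u) * x \<le> v" if "x \<in> {0..1}" for x
  proof -
    have "(v - u) * x \<le> v - u" using assms that by (intro mult_left_le) auto
    moreover have "0 \<le> (v - u) * x" using assms that by simp
    ultimately show "u \<le> u + (v - u) * x" "u + (v - u) * x \<le> v" by linarith+
  qed
  have al: "curve_length ?\<beta> 0 x = ennreal (arc_length \<gamma> (u + (v - u) * x) - arc_length \<gamma> u)"
    if "x \<in> {0..1}" for x
    using sub[OF that] assms curve_length_affine[OF assms(2), of \<gamma> 0 x] by (simp add: curve_length_eq_arc_length)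
  have mono: "arc_length \<gamma> u \<le> arc_length \<gamma> v" using assms by (intro arc_length_mono) auto
  have param: "arclength_param ?\<beta> s = clamped_param (arc_length \<gamma> u + s)"
    if s: "s \<in> {0..arc_length \<gamma> v - arc_length \<gamma> u}" for s
  proof -
    obtain t where t: "u \<le> t" "t \<le> v" "arc_length \<gamma> t = arc_length \<gamma> u + s"
      using arc_length_surj[of u v "arc_length \<gamma> u + s"] assms s by auto
    define x where "x = (t - u) / (v - u)"
    have x: "x \<in> {0..1}" "u + (v - u) * x = t"
      using t assms by (auto simp: x_def divide_simps)
    have "curve_length ?\<beta> 0 x = ennreal s"
      using al[OF x(1)] t unfolding x(2) by simp
    then have "arclength_param ?\<beta> s = \<gamma> t"
      unfolding arclength_param_def
    \<comment> \<open>Different times of equal length name the same point, since both points are the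
      value of \<open>clamped_param\<close> at that length.\<close>
    proof (intro the_equality)
      fix y assume "\<exists>r\<in>{0..1}. curve_length ?\<beta> 0 r = ennreal s \<and> y = ?\<beta> r"
      then obtain r where r: "r \<in> {0..1}" "curve_length ?\<beta> 0 r = ennreal s" "y = ?\<beta> r" by auto
      have "arc_length \<gamma> u \<le> arc_length \<gamma> (u + (v - u) * r)"
        using sub[OF r(1)] assms by (intro arc_length_mono) auto
      then have "arc_length \<gamma> (u + (v - u) * r) = arc_length \<gamma> t"
        using r al[OF r(1)] s t by simp
      then show "y = \<gamma> t"
        using clamped_param_arc_length[of t] clamped_param_arc_length[of "u + (v - u) * r"]
          sub[OF r(1)] assms t r(3) by auto
    qed (use x in auto)
    then show ?thesis using t assms clamped_param_arc_length[of t] by auto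
  qed
  have "line_integral ?\<beta> g =
      (\<integral>\<^sup>+ s\<in>{0..arc_length \<gamma> v - arc_length \<gamma> u}. g (clamped_param (arc_length \<gamma> u + s)) \<partial>lborel)"
    unfolding line_integral_def using al[of 1] mono
    by (intro nn_integral_cong) (auto simp: param split: split_indicator)
  \<comment> \<open>The translation is written as an affine map of slope 1 to fit the change of
    variables rule.\<close>
  also have "\<dots> = (\<integral>\<^sup>+ s. (g (clamped_param (arc_length \<gamma> u + 1 * s))
      * indicator {arc_length \<gamma> u..arc_length \<gamma> v} (arc_length \<gamma> u + 1 * s)) \<partial>lborel)"
    by (intro nn_integral_cong) (auto split: split_indicator)
  also have "\<dots> = (\<integral>\<^sup>+ s\<in>{arc_length \<gamma> u..arc_length \<gamma> v}. g (clamped_param s) \<partial>lborel)"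
    using nn_integral_real_affine[of "\<lambda>s. g (clamped_param s) * indicator {arc_length \<gamma> u..arc_length \<gamma> v} s" 1 "arc_length \<gamma> u"]
    by simp
  finally show ?thesis .
qed

text \<open>An upper gradient controls only endpoints of curves on the unit interval; rescaling
  subcurves to that interval extends the control to any two points of the curve.\<close>

lemma upper_gradient_dist_le:
  assumes "upper_gradient g f" "0 \<le> u" "u \<le> v" "v \<le> 1"
  shows "ennreal (dist (f (\<gamma> u)) (f (\<gamma> v)))
    \<le> (\<integral>\<^sup>+ s\<in>{arc_length \<gamma> u..arc_length \<gamma> v}. g (clamped_param s) \<partial>lborel)"
proof (cases "u = v")
  case False
  then have uv: "0 \<le> u" "u < v" "v \<le> 1" using assms by auto
  have "ennreal (dist (f (\<gamma> (u + (v - u) * 0))) (f (\<gamma> (u + (v - u) * 1))))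
      \<le> line_integral (\<lambda>x. \<gamma> (u + (v - u) * x)) g"
    using assms(1) rectifiable_restrict[OF uv] unfolding upper_gradient_def by blast
  then show ?thesis
    using assms(1) line_integral_restrict[OF uv, of g] by (simp add: upper_gradient_def)
qed simp

lemma upper_gradient_dist_le_line_integral:
  assumes "upper_gradient g f" "u \<in> {0..1}" "v \<in> {0..1}"
  shows "ennreal (dist (f (\<gamma> u)) (f (\<gamma> v))) \<le> line_integral \<gamma> g"
proof -
  have "ennreal (dist (f (\<gamma> u)) (f (\<gamma> v))) \<le> line_integral \<gamma> g"
    if "u \<le> v" "u \<in> {0..1}" "v \<in> {0..1}" for u v
  proof -
    have "ennreal (dist (f (\<gamma> u)) (f (\<gamma> v)))
      \<le> (\<integral>\<^sup>+ s\<in>{arc_length \<gamma> u..arc_length \<gamma> v}. g (clamped_param s) \<partial>lborel)"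
      using that assms(1) by (intro upper_gradient_dist_le) auto
    also have "\<dots> \<le> line_integral \<gamma> g"
      unfolding line_integral_clamped_param
      using arc_length_range[OF that(2)] arc_length_range[OF that(3)]
      by (intro nn_integral_mono) (auto split: split_indicator)
    finally show ?thesis .
  qed
  from this[of u v] this[of v u] show ?thesis
    using assms by (cases "u \<le> v") (auto simp: dist_commute)
qed

lemma line_integral_cmult:
  assumes [measurable]: "g \<in> borel_measurable borel"
  shows "line_integral \<gamma> (\<lambda>x. c * g x) = c * line_integral \<gamma> g"
  unfolding line_integral_clamped_param
  by (subst nn_integral_cmult[symmetric]) (auto simp: mult.assoc)

text \<open>The integrand over arc length is the density of a finite measure without atoms, whose
  distribution function is therefore continuous. The map \<open>w\<close> oscillates no more than
  that function composed with arc length.\<close>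

lemma continuous_on_of_dist_le_line_integral:
  fixes w :: "real \<Rightarrow> 'z::metric_space"
  assumes [measurable]: "g \<in> borel_measurable borel" and fin: "line_integral \<gamma> g < \<infinity>"
    and dist: "\<And>u v. \<lbrakk>0 \<le> u; u \<le> v; v \<le> 1\<rbrakk> \<Longrightarrow> ennreal (dist (w u) (w v))
      \<le> (\<integral>\<^sup>+ s\<in>{arc_length \<gamma> u..arc_length \<gamma> v}. g (clamped_param s) \<partial>lborel)"
  shows "continuous_on {0..1} w"
proof -
  define L where "L = arc_length \<gamma> 1"
  define \<nu> where "\<nu> = density lborel (\<lambda>s. g (clamped_param s) * indicator {0..L} s)"
  have em: "emeasure \<nu> A = (\<integral>\<^sup>+ s\<in>A. (g (clamped_param s) * indicator {0..L} s) \<partial>lborel)"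
    if "A \<in> sets borel" for A
    using that unfolding \<nu>_def by (subst emeasure_density) auto
  interpret \<nu>: finite_borel_measure \<nu>
  proof (intro finite_borel_measure.intro finite_measureI finite_borel_measure_axioms.intro)
    have "emeasure \<nu> UNIV < \<infinity>"
      using fin by (simp add: em line_integral_clamped_param L_def)
    then show "emeasure \<nu> (space \<nu>) \<noteq> \<infinity>" by (simp add: \<nu>_def)
    show "sets \<nu> = sets borel" by (simp add: \<nu>_def)
  qed
  have point: "emeasure \<nu> {x} = 0" for x
    by (simp add: em AE_lborel_singleton nn_integral_0_iff_AE)
  then have cont: "isCont (cdf \<nu>) x" for x
    by (simp add: \<nu>.isCont_cdf measure_def)
  have le: "dist (w u) (w v) \<le> cdf \<nu> (arc_length \<gamma> v) - cdf \<nu> (arc_length \<gamma> u)"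
    if uv: "0 \<le> u" "u \<le> v" "v \<le> 1" for u v
  proof -
    have r: "0 \<le> arc_length \<gamma> u" "arc_length \<gamma> u \<le> arc_length \<gamma> v" "arc_length \<gamma> v \<le> L"
      using arc_length_range[of u] arc_length_range[of v] arc_length_mono[of u v] uv by (auto simp: L_def)
    have "ennreal (dist (w u) (w v)) \<le> emeasure \<nu> {arc_length \<gamma> u..arc_length \<gamma> v}"
      using dist[OF uv] r by (subst em)
         (auto intro!: order.trans[OF dist[OF uv]] nn_integral_mono split: split_indicator)
    also have "{arc_length \<gamma> u..arc_length \<gamma> v} = {arc_length \<gamma> u} \<union> {arc_length \<gamma> u<..arc_length \<gamma> v}"
      using r by auto
    also have "emeasure \<nu> \<dots> \<le> emeasure \<nu> {arc_length \<gamma> u} + emeasure \<nu> {arc_length \<gamma> u<..arc_length \<gamma> v}"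
      by (intro emeasure_subadditive) auto
    also have "\<dots> = emeasure \<nu> {arc_length \<gamma> u<..arc_length \<gamma> v}" by (simp add: point)
    finally have "ennreal (dist (w u) (w v)) \<le> ennreal (measure \<nu> {arc_length \<gamma> u<..arc_length \<gamma> v})"
      by (simp add: \<nu>.emeasure_eq_measure)
    then have "dist (w u) (w v) \<le> measure \<nu> {arc_length \<gamma> u<..arc_length \<gamma> v}"
      by (subst (asm) ennreal_le_iff) auto
    \<comment> \<open>The formula for the difference needs a strict inequality; when the two arc
      lengths coincide the half-open interval is empty.\<close>
    then show ?thesis
      using r \<nu>.cdf_diff_eq[of "arc_length \<gamma> u" "arc_length \<gamma> v"]
      by (cases "arc_length \<gamma> u = arc_length \<gamma> v") auto
  qed
  have le': "dist (w u) (w v) \<le> dist (cdf \<nu> (arc_length \<gamma> u)) (cdf \<nu> (arc_length \<gamma> v))"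
    if "u \<in> {0..1}" "v \<in> {0..1}" for u v
    using le[of u v] le[of v u] that by (cases "u \<le> v") (auto simp: dist_real_def dist_commute)
  have "continuous_on {0..1} (\<lambda>t. cdf \<nu> (arc_length \<gamma> t))"
    by (rule continuous_on_compose2[OF _ continuous_on_arc_length, of UNIV])
      (auto intro!: continuous_at_imp_continuous_on cont)
  then show ?thesis
    unfolding continuous_on_iff using le' by (meson le_less_trans)
qed

end

section \<open>Sets of capacity zero\<close>

text \<open>The powers \<open>p\<close> and \<open>1 / p\<close> form an order adjunction on the
  extended half-line. Monotonicity and compatibility with suprema then follow without separate
  treatment of infinity.\<close>

lemma epowr_le_iff:
  assumes "0 < p"
  shows "epowr a p \<le> b \<longleftrightarrow> a \<le> epowr b (1 / p)"
proof (cases a; cases b)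
  fix x y :: real assume a: "a = ennreal x" "0 \<le> x" and b: "b = ennreal y" "0 \<le> y"
  have "x powr p \<le> y \<longleftrightarrow> x \<le> y powr (1 / p)"
  proof
    assume "x powr p \<le> y"
    then have "(x powr p) powr (1 / p) \<le> y powr (1 / p)"
      using assms by (intro powr_mono2) auto
    then show "x \<le> y powr (1 / p)" using assms a by (simp add: powr_powr)
  next
    assume "x \<le> y powr (1 / p)"
    then have "x powr p \<le> (y powr (1 / p)) powr p"
      using assms a by (intro powr_mono2) auto
    then show "x powr p \<le> y" using assms b by (simp add: powr_powr)
  qed
  then show ?thesis using a b by (simp add: epowr_def)
qed (auto simp: epowr_def top_unique)

lemma epowr_mono:
  assumes "0 < p" "a \<le> b"
  shows "epowr a p \<le> epowr b p"
proof -
  have "b \<le> epowr (epowr b p) (1 / p)" using epowr_le_iff[OF assms(1), of b "epowr b p"] by simp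
  then show ?thesis using assms epowr_le_iff[OF assms(1), of a "epowr b p"] by simp
qed

text \<open>The power is the lower adjoint in \<open>epowr_le_iff\<close>, and lower adjoints
  preserve suprema.\<close>

lemma epowr_SUP_le:
  assumes "0 < p"
  shows "epowr (SUP i\<in>I. f i) p \<le> (SUP i\<in>I. epowr (f i) p)"
  unfolding epowr_le_iff[OF assms]
proof (rule SUP_least)
  fix i assume "i \<in> I"
  then have "epowr (f i) p \<le> (SUP i\<in>I. epowr (f i) p)" by (rule SUP_upper)
  then show "f i \<le> epowr (SUP i\<in>I. epowr (f i) p) (1 / p)"
    unfolding epowr_le_iff[OF assms] .
qed

lemma epowr_max: "0 < p \<Longrightarrow> epowr (max a b) p = max (epowr a p) (epowr b p)"
  using epowr_mono[of p a b] epowr_mono[of p b a] by (cases "a \<le> b") (auto simp: max_def)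

lemma epowr_cmult:
  assumes "0 < c"
  shows "epowr (ennreal c * a) p = ennreal (c powr p) * epowr a p"
proof (cases a)
  case (real x)
  then have ca: "ennreal c * a = ennreal (c * x)" using assms by (simp add: ennreal_mult)
  have e: "epowr (ennreal y) p = ennreal (y powr p)" if "0 \<le> y" for y
    using that by (simp add: epowr_def)
  have "epowr (ennreal c * a) p = ennreal ((c * x) powr p)"
    unfolding ca using assms real by (intro e) auto
  also have "\<dots> = ennreal (c powr p) * ennreal (x powr p)"
    using assms real by (subst ennreal_mult[symmetric]) (auto simp: powr_mult)
  finally show ?thesis using real by (simp add: e)
next
  case top
  then show ?thesis using assms by (simp add: epowr_def ennreal_mult_top)
qed

lemma measurable_epowr [measurable (raw)]:
  assumes [measurable]: "f \<in> borel_measurable M"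
  shows "(\<lambda>x. epowr (f x) p) \<in> borel_measurable M"
proof -
  have [measurable]: "{x \<in> space M. f x = \<infinity>} \<in> sets M"
    using measurable_sets[OF assms, of "{\<infinity>}"] by (simp add: vimage_def Int_def conj_commute)
  show ?thesis unfolding epowr_def by measurable
qed

text \<open>A crude substitute for the Hoelder inequality: over a finite measure it turns
  \<open>p\<close>-integrability into integrability.\<close>

lemma le_one_plus_epowr:
  assumes "1 \<le> p"
  shows "a \<le> 1 + epowr a p"
proof (cases a)
  case (real x)
  have "x \<le> 1 + x powr p"
  proof (cases "x \<le> 1")
    case False
    then have "x powr 1 \<le> x powr p" using assms by (intro powr_mono) auto
    then show ?thesis using False by simp
  qed (use powr_ge_zero[of x p] in linarith)
  then have "ennreal x \<le> ennreal (1 + x powr p)" by (rule ennreal_leI)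
  then show ?thesis using real by (simp add: epowr_def)
qed (simp add: epowr_def)

section \<open>Capacity zero and exceptional curves\<close>

lemma capacity_mono: "E \<subseteq> F \<Longrightarrow> capacity M p E \<le> capacity M p F"
  unfolding capacity_def by (rule INF_superset_mono) (blast, rule order_refl)

text \<open>Two infima are opened in turn, over admissible functions and over their upper gradients.
  One bound \<epsilon> serves both integrals because the norm power is their sum.\<close>

lemma capacity_zero_witness:
  assumes "capacity M p E = 0" "0 < \<epsilon>"
  obtains f :: "'x::metric_space \<Rightarrow> real" and g where "f \<in> borel_measurable (completion M)"
    "\<And>x. x \<in> E \<Longrightarrow> 1 \<le> f x" "upper_gradient g f"
    "(\<integral>\<^sup>+ x. ennreal (\<bar>f x\<bar> powr p) \<partial>completion M) \<le> \<epsilon>" "(\<integral>\<^sup>+ x. epowr (g x) p \<partial>M) \<le> \<epsilon>"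
proof -
  have "capacity M p E < \<epsilon>" using assms by simp
  then obtain f :: "'x \<Rightarrow> real" where f: "f \<in> newtonian M p" "\<forall>x\<in>E. 1 \<le> f x" "newtonian_norm_pow M p f < \<epsilon>"
    unfolding capacity_def INF_less_iff by blast
  let ?I = "INF g \<in> {g. upper_gradient g f}. \<integral>\<^sup>+ x. epowr (g x) p \<partial>M"
  have "(\<integral>\<^sup>+ x. ennreal (\<bar>f x\<bar> powr p) \<partial>completion M) \<le> newtonian_norm_pow M p f"
    "?I \<le> newtonian_norm_pow M p f"
    unfolding newtonian_norm_pow_def by auto
  then have "(\<integral>\<^sup>+ x. ennreal (\<bar>f x\<bar> powr p) \<partial>completion M) \<le> \<epsilon>" "?I < \<epsilon>"
    using f(3) by (auto dest: le_less_trans)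
  moreover from this(2) obtain g where "upper_gradient g f" "(\<integral>\<^sup>+ x. epowr (g x) p \<partial>M) \<le> \<epsilon>"
    unfolding INF_less_iff by (auto dest: less_imp_le)
  ultimately show ?thesis using f that by (auto simp: newtonian_def)
qed

text \<open>A curve of finite \<open>\<rho>\<close>-length that meets \<open>E\<close> would run inside the null set on which \<open>\<rho>\<close>
  is infinite: the admissible functions \<open>f n\<close> are small outside that set, at least \<open>1\<close> on \<open>E\<close>, and
  their variation along the curve is at most \<open>2\<^sup>-\<^sup>n\<close> times its \<open>\<rho>\<close>-length.\<close>

lemma capacity_zero_exceptional:
  fixes M :: "'x::metric_space measure"
  assumes p: "0 < p" and M: "sets M = sets borel" and cap: "capacity M p E = 0"
  obtains N \<rho> where "N \<in> null_sets M" "E \<subseteq> N" "\<rho> \<in> borel_measurable borel"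
    "(\<integral>\<^sup>+ x. epowr (\<rho> x) p \<partial>M) < \<infinity>"
    "\<And>\<gamma> t. \<lbrakk>rectifiable \<gamma>; line_integral \<gamma> \<rho> < \<infinity>; 0 < arc_length \<gamma> 1; t \<in> {0..1}\<rbrakk> \<Longrightarrow> \<gamma> t \<notin> E"
proof -
  have space_M: "space M = UNIV" using sets_eq_imp_space_eq[OF M] by simp
  have mM: "f \<in> borel_measurable M" if "f \<in> borel_measurable borel" for f :: "'x \<Rightarrow> ennreal"
    using that measurable_cong_sets[OF M refl, of borel] by auto
  \<comment> \<open>The divisor compensates the later multiplication of \<open>g n\<close> by
    \<open>2^n\<close>, leaving energies \<open>(1/2)^n\<close> with finite sum; since it is at
    least 1, the sets \<open>S n\<close> shrink as well.\<close>
  define \<epsilon> :: "nat \<Rightarrow> real" where "\<epsilon> n = (1/2)^n / (2^n) powr p" for n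
  have \<epsilon>: "0 < \<epsilon> n" for n by (simp add: \<epsilon>_def)
  have "\<exists>f g. f \<in> borel_measurable (completion M) \<and> (\<forall>x\<in>E. 1 \<le> f x) \<and> upper_gradient g f \<and>
      (\<integral>\<^sup>+ x. ennreal (\<bar>f x\<bar> powr p) \<partial>completion M) \<le> \<epsilon> n \<and> (\<integral>\<^sup>+ x. epowr (g x) p \<partial>M) \<le> \<epsilon> n"
    for n
    using capacity_zero_witness[OF cap, of "ennreal (\<epsilon> n)"] \<epsilon>[of n] by (metis ennreal_less_zero_iff)
  then obtain f g where f [measurable]: "\<And>n. f n \<in> borel_measurable (completion M)"
    and fE: "\<And>n x. x \<in> E \<Longrightarrow> 1 \<le> f n x" and fg: "\<And>n. upper_gradient (g n) (f n)"
    and f_int: "\<And>n. (\<integral>\<^sup>+ x. ennreal (\<bar>f n x\<bar> powr p) \<partial>completion M) \<le> \<epsilon> n"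
    and g_int: "\<And>n. (\<integral>\<^sup>+ x. epowr (g n x) p \<partial>M) \<le> \<epsilon> n"
    by metis
  have g [measurable]: "g n \<in> borel_measurable borel" for n
    using fg[of n] by (simp add: upper_gradient_def)

  \<comment> \<open>On \<open>E\<close> the functions are at least 1; the lower threshold leaves a
    margin of 1/2 for their variation along a curve.\<close>
  define S where "S n = {x. 1/2 \<le> f n x}" for n
  have S [measurable]: "S n \<in> sets (completion M)" for n
    unfolding S_def using measurable_sets[OF f[of n], of "{1/2..}"] by (simp add: vimage_def space_M)
  have S_le: "emeasure (completion M) (S n) \<le> ennreal (2 powr p * (1/2)^n)" for n
  proof -
    have "emeasure (completion M) (S n) = (\<integral>\<^sup>+ x. indicator (S n) x \<partial>completion M)" by simp
    also have "\<dots> \<le> (\<integral>\<^sup>+ x. ennreal (2 powr p) * ennreal (\<bar>f n x\<bar> powr p) \<partial>completion M)"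
    proof (intro nn_integral_mono)
      fix x
      have "1 \<le> 2 powr p * \<bar>f n x\<bar> powr p" if "1/2 \<le> f n x"
      proof -
        have "1 powr p \<le> (2 * \<bar>f n x\<bar>) powr p" using that p by (intro powr_mono2) auto
        then show ?thesis by (simp add: powr_mult)
      qed
      then show "indicator (S n) x \<le> ennreal (2 powr p) * ennreal (\<bar>f n x\<bar> powr p)"
        by (auto simp: S_def ennreal_mult[symmetric] split: split_indicator)
    qed
    also have "\<dots> = ennreal (2 powr p) * (\<integral>\<^sup>+ x. ennreal (\<bar>f n x\<bar> powr p) \<partial>completion M)"
      by (rule nn_integral_cmult) measurable
    also have "\<dots> \<le> ennreal (2 powr p) * ennreal (\<epsilon> n)" by (intro mult_left_mono f_int) auto
    also have "\<dots> = ennreal (2 powr p * \<epsilon> n)" using \<epsilon>[of n] by (simp add: ennreal_mult)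
    also have "\<dots> \<le> ennreal (2 powr p * (1/2)^n)"
    proof (intro ennreal_leI mult_left_mono)
      have "1 \<le> (2^n :: real) powr p" using p by (intro ge_one_powr_ge_zero) auto
      then show "\<epsilon> n \<le> (1/2)^n" by (auto simp: \<epsilon>_def divide_le_eq intro!: mult_left_mono)
    qed auto
    finally show ?thesis .
  qed
  \<comment> \<open>Each tail intersection lies in every later \<open>S n\<close>, and the measures
    of these tend to 0.\<close>
  have T: "(\<Inter>n\<in>{m..}. S n) \<in> null_sets (completion M)" for m
  proof -
    have "(\<lambda>n. ennreal (2 powr p * (1/2)^n)) \<longlonglongrightarrow> ennreal (2 powr p * 0)"
      by (intro tendsto_ennrealI tendsto_mult tendsto_const LIMSEQ_power_zero) auto
    moreover have "emeasure (completion M) (\<Inter>n\<in>{m..}. S n) \<le> ennreal (2 powr p * (1/2)^n)" if "n \<ge> m" for n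
      using emeasure_mono[of "\<Inter>n\<in>{m..}. S n" "S n" "completion M"] that S_le[of n]
      by (force intro: order_trans)
    ultimately have "emeasure (completion M) (\<Inter>n\<in>{m..}. S n) \<le> ennreal (2 powr p * 0)"
      by (intro tendsto_lowerbound[where F = sequentially]) (auto simp: eventually_sequentially)
    then show ?thesis by (auto intro!: null_setsI)
  qed
  then have "(\<Union>m. \<Inter>n\<in>{m..}. S n) \<in> null_sets (completion M)"
    by auto
  \<comment> \<open>The union of the tails is measurable only for the completion; a null superset in
    \<open>M\<close> keeps \<rho> Borel.\<close>
  then obtain N where N: "N \<in> null_sets M" "(\<Union>m. \<Inter>n\<in>{m..}. S n) \<subseteq> N"
    unfolding null_sets_completion_iff2 by blast
  then have N_borel [measurable]: "N \<in> sets borel" using M by auto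

  \<comment> \<open>The supremum dominates all \<open>2^n * g n\<close> at once. The second term
    costs no energy because \<open>N\<close> is null.\<close>
  define \<rho> where "\<rho> x = max (SUP n. ennreal (2^n) * g n x) (\<infinity> * indicator N x)" for x
  have \<rho> [measurable]: "\<rho> \<in> borel_measurable borel"
    unfolding \<rho>_def by measurable
  have "(\<integral>\<^sup>+ x. epowr (\<rho> x) p \<partial>M)
      \<le> (\<integral>\<^sup>+ x. (\<Sum>n. ennreal ((2^n) powr p) * epowr (g n x) p) + \<infinity> * indicator N x \<partial>M)"
  proof (intro nn_integral_mono)
    fix x
    have "epowr (SUP n. ennreal (2^n) * g n x) p \<le> (SUP n. epowr (ennreal (2^n) * g n x) p)"
      by (rule epowr_SUP_le[OF p])
    also have "\<dots> = (SUP n. ennreal ((2^n) powr p) * epowr (g n x) p)"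
      by (subst epowr_cmult) auto
    also have "\<dots> \<le> (\<Sum>n. ennreal ((2^n) powr p) * epowr (g n x) p)"
    proof (rule SUP_least)
      fix n
      show "ennreal ((2^n) powr p) * epowr (g n x) p \<le> (\<Sum>n. ennreal ((2^n) powr p) * epowr (g n x) p)"
        using sum_le_suminf[of "\<lambda>n. ennreal ((2^n) powr p) * epowr (g n x) p" "{n}"] by auto
    qed
    finally have 1: "epowr (SUP n. ennreal (2^n) * g n x) p \<le> (\<Sum>n. ennreal ((2^n) powr p) * epowr (g n x) p)" .
    have 2: "epowr (\<infinity> * indicator N x) p \<le> \<infinity> * indicator N x"
      by (auto simp: epowr_def split: split_indicator)
    show "epowr (\<rho> x) p \<le> (\<Sum>n. ennreal ((2^n) powr p) * epowr (g n x) p) + \<infinity> * indicator N x"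
      unfolding \<rho>_def epowr_max[OF p] using 1 2
      by (intro max.boundedI) (auto intro: add_increasing add_increasing2)
  qed
  also have "\<dots> = (\<integral>\<^sup>+ x. (\<Sum>n. ennreal ((2^n) powr p) * epowr (g n x) p) \<partial>M)"
    using AE_not_in[OF N(1)] by (intro nn_integral_cong_AE) (auto elim!: eventually_mono)
  also have "\<dots> = (\<Sum>n. ennreal ((2^n) powr p) * (\<integral>\<^sup>+ x. epowr (g n x) p \<partial>M))"
    by (subst nn_integral_suminf) (auto intro!: mM simp: nn_integral_cmult mM)
  also have "\<dots> \<le> (\<Sum>n. ennreal ((1/2)^n))"
  proof (intro suminf_le)
    fix n
    have "ennreal ((2^n) powr p) * (\<integral>\<^sup>+ x. epowr (g n x) p \<partial>M) \<le> ennreal ((2^n) powr p) * ennreal (\<epsilon> n)"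
      by (intro mult_left_mono g_int) auto
    also have "\<dots> = ennreal ((1/2)^n)"
      by (subst ennreal_mult[symmetric]) (auto simp: \<epsilon>_def)
    finally show "ennreal ((2^n) powr p) * (\<integral>\<^sup>+ x. epowr (g n x) p \<partial>M) \<le> ennreal ((1/2)^n)" .
  qed auto
  also have "\<dots> = ennreal (\<Sum>n. (1/2)^n)"
    by (intro suminf_ennreal2) auto
  also have "\<dots> < \<infinity>" by simp
  finally have \<rho>_int: "(\<integral>\<^sup>+ x. epowr (\<rho> x) p \<partial>M) < \<infinity>" .

  have EN: "E \<subseteq> N"
  proof
    fix x assume "x \<in> E"
    then have "x \<in> S n" for n using fE[of x n] by (simp add: S_def)
    then show "x \<in> N" using N(2) by blast
  qed

  show ?thesis
  proof (rule that[OF N(1) EN \<rho> \<rho>_int])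
    fix \<gamma> :: "real \<Rightarrow> 'x" and t0 :: real
    assume t0: "t0 \<in> {0..1}" and rect: "rectifiable \<gamma>" and fin: "line_integral \<gamma> \<rho> < \<infinity>" and L: "0 < arc_length \<gamma> 1"
    show "\<gamma> t0 \<notin> E"
    proof
      assume t0_E: "\<gamma> t0 \<in> E"
      obtain I where I: "line_integral \<gamma> \<rho> = ennreal I" "0 \<le> I"
        using fin by (cases "line_integral \<gamma> \<rho>") auto
      have var: "dist (f n (\<gamma> t)) (f n (\<gamma> t0)) \<le> I / 2^n" if "t \<in> {0..1}" for n t
      proof -
        have "ennreal (2^n) * ennreal (dist (f n (\<gamma> t)) (f n (\<gamma> t0))) \<le> ennreal (2^n) * line_integral \<gamma> (g n)"
          by (intro mult_left_mono upper_gradient_dist_le_line_integral[OF rect fg that t0]) auto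
        also have "\<dots> = line_integral \<gamma> (\<lambda>x. ennreal (2^n) * g n x)"
          by (rule line_integral_cmult[OF rect, symmetric]) measurable
        also have "\<dots> \<le> line_integral \<gamma> \<rho>"
          unfolding \<rho>_def by (intro line_integral_mono max.coboundedI1 SUP_upper UNIV_I)
        finally have "2^n * dist (f n (\<gamma> t)) (f n (\<gamma> t0)) \<le> I"
          unfolding I using I(2) by (simp add: ennreal_mult[symmetric])
        then show ?thesis by (simp add: field_simps)
      qed
      have "(\<lambda>n. I * (1/2)^n) \<longlonglongrightarrow> I * 0"
        by (intro tendsto_mult tendsto_const LIMSEQ_power_zero) auto
      then have "\<forall>\<^sub>F n in sequentially. I * (1/2)^n < 1/2"
        by (rule order_tendstoD) auto
      then obtain m where m: "\<And>n. n \<ge> m \<Longrightarrow> I / 2^n < 1/2"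
        by (auto simp: eventually_sequentially power_one_over field_simps)
      have "\<gamma> t \<in> N" if t: "t \<in> {0..1}" for t
      proof -
        have "1/2 \<le> f n (\<gamma> t)" if "n \<ge> m" for n
          using var[OF t, of n] m[OF that] fE[OF t0_E, of n] unfolding dist_real_def by linarith
        then show ?thesis using N(2) by (auto simp: S_def)
      qed
      then have "clamped_param \<gamma> s \<in> N" for s
        using clamped_param_in_image[OF rect, of s] by auto
      then have "line_integral \<gamma> \<rho> = (\<integral>\<^sup>+ s. \<infinity> * indicator {0..arc_length \<gamma> 1} s \<partial>lborel)"
        unfolding line_integral_clamped_param[OF rect] by (simp add: \<rho>_def)
      \<comment> \<open>Positive length is decisive here: over a single parameter value even an
        infinite integrand has integral 0.\<close>
      also have "\<dots> = \<infinity>"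
        using L by (subst nn_integral_cmult_indicator) (auto simp: ennreal_top_mult)
      finally show False using fin by simp
    qed
  qed
qed

section \<open>Maps along curves\<close>

text \<open>The agreement set is closed as a level set of a continuous distance. It is open because
  near an agreement time both paths stay in one ball on which \<phi> preserves distances.
  Connectedness of the interval does the rest.\<close>

lemma lift_unique_on_interval:
  fixes w1 w2 :: "real \<Rightarrow> 'z::metric_space"
  assumes \<phi>: "local_isometry \<phi>" and w: "continuous_on {0..1} w1" "continuous_on {0..1} w2"
    and eq: "\<And>t. t \<in> {0..1} \<Longrightarrow> \<phi> (w1 t) = \<phi> (w2 t)"
    and ab: "a \<in> {0..1}" "b \<in> {0..1}" "w1 a = w2 a"
  shows "w1 b = w2 b"
proof -
  let ?D = "{t\<in>{0..1}. dist (w1 t) (w2 t) = 0}"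
  have "openin (top_of_set {0..1}) ?D"
  proof (subst openin_subopen, intro ballI)
    fix t assume t: "t \<in> ?D"
    obtain r where r: "0 < r" "\<And>a b. \<lbrakk>a \<in> ball (w1 t) r; b \<in> ball (w1 t) r\<rbrakk> \<Longrightarrow> dist (\<phi> a) (\<phi> b) = dist a b"
      using \<phi> unfolding local_isometry_def by metis
    let ?U = "({0..1} \<inter> w1 -` ball (w1 t) r) \<inter> ({0..1} \<inter> w2 -` ball (w1 t) r)"
    have "openin (top_of_set {0..1}) ?U"
      by (intro openin_Int continuous_openin_preimage_gen w) auto
    moreover have "t \<in> ?U" using t r by auto
    moreover have "?U \<subseteq> ?D"
    proof
      fix x assume x: "x \<in> ?U"
      then have "dist (w1 x) (w2 x) = dist (\<phi> (w1 x)) (\<phi> (w2 x))" by (intro r(2)[symmetric]) auto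
      also have "\<dots> = 0" using eq[of x] x by simp
      finally show "x \<in> ?D" using x by simp
    qed
    ultimately show "\<exists>T. openin (top_of_set {0..1}) T \<and> t \<in> T \<and> T \<subseteq> ?D" by blast
  qed
  moreover have "closedin (top_of_set {0..1}) ?D"
    by (rule continuous_closedin_preimage_constant) (intro continuous_intros w)
  moreover have "connected {0..1::real}" by simp
  ultimately have "?D = {} \<or> ?D = {0..1}"
    unfolding connected_clopen by blast
  moreover have "a \<in> ?D" using ab by simp
  ultimately have "b \<in> ?D" using ab(2) by blast
  then show ?thesis by simp
qed

text \<open>Subtracting \<open>dist (s 0) (s n)\<close> makes the sequence bounded, by the reverse
  triangle inequality; boundedness is what allows \<open>Bcontfun\<close> to be inverted.\<close>

lemma apply_kuratowski: "apply_bcontfun (kuratowski s z) n = dist z (s n) - dist (s 0) (s n)"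
proof -
  have "(\<lambda>n. dist z (s n) - dist (s 0) (s n)) \<in> bcontfun"
  proof (rule bcontfun_normI)
    show "norm (dist z (s n) - dist (s 0) (s n)) \<le> dist z (s 0)" for n
      using abs_dist_diff_le[of z "s n" "s 0"] by (simp add: dist_commute)
  qed simp
  then show ?thesis by (simp add: kuratowski_def Bcontfun_inverse)
qed

text \<open>A coordinate whose base point \<open>s n\<close> is close to \<open>w\<close> nearly
  attains the distance. This half of the isometry carries estimates from the embedded map back to
  the original one.\<close>

lemma dist_kuratowski_ge:
  assumes "closure (range s) = UNIV"
  shows "dist z w \<le> dist (kuratowski s z) (kuratowski s w)"
proof (rule field_le_epsilon)
  fix e :: real assume "0 < e"
  then obtain n where n: "dist (s n) w < e / 2"
    using assms closure_approachable[of w "range s"] by (metis UNIV_I half_gt_zero rangeE)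
  have "dist z (s n) - dist w (s n) \<le> dist (kuratowski s z) (kuratowski s w)"
    using dist_bounded[of "kuratowski s z" n "kuratowski s w"] by (simp add: apply_kuratowski dist_real_def)
  then show "dist z w \<le> dist (kuratowski s z) (kuratowski s w) + e"
    using n dist_triangle[of z w "s n"] by (simp add: dist_commute)
qed

text \<open>The upper gradient belongs to the representative \<open>v\<close>, not to
  \<open>h\<close>. Agreement through the embedding along the entire curve transfers its bound to
  \<open>h\<close>.\<close>

lemma newtonian_into_continuous_along:
  fixes h :: "'x::metric_space \<Rightarrow> 'z::metric_space"
  assumes rect: "rectifiable \<gamma>" and s: "closure (range s) = UNIV"
    and v: "\<And>t. t \<in> {0..1} \<Longrightarrow> v (\<gamma> t) = kuratowski s (h (\<gamma> t))"
    and g: "upper_gradient g v" "line_integral \<gamma> g < \<infinity>"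
  shows "continuous_on {0..1} (h \<circ> \<gamma>)"
proof (rule continuous_on_of_dist_le_line_integral[OF rect])
  show "g \<in> borel_measurable borel" using g by (simp add: upper_gradient_def)
  fix u w :: real assume uw: "0 \<le> u" "u \<le> w" "w \<le> 1"
  have "dist ((h \<circ> \<gamma>) u) ((h \<circ> \<gamma>) w) \<le> dist (v (\<gamma> u)) (v (\<gamma> w))"
    using dist_kuratowski_ge[OF s] v uw by simp
  then show "ennreal (dist ((h \<circ> \<gamma>) u) ((h \<circ> \<gamma>) w))
      \<le> (\<integral>\<^sup>+ x\<in>{arc_length \<gamma> u..arc_length \<gamma> w}. g (clamped_param \<gamma> x) \<partial>lborel)"
    using upper_gradient_dist_le[OF rect g(1) uw] by (meson ennreal_leI order_trans)
qed (use g in simp)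

section \<open>Sets whose indicator has small upper gradients\<close>

lemma quasieverywhere_AE:
  assumes "0 < p" "sets M = sets borel" "quasieverywhere M p P"
  shows "AE x in completion M. P x"
proof -
  obtain N where "N \<in> null_sets M" "{x. \<not> P x} \<subseteq> N"
    using capacity_zero_exceptional[OF assms(1,2)] assms(3) unfolding quasieverywhere_def by metis
  then have "AE x in M. P x" by (intro AE_I'[of N]) auto
  then show ?thesis by (rule AE_completion)
qed

text \<open>Two lifts may come with different dense sequences, so their Kuratowski coordinates are
  not directly comparable, while distances to arbitrary points are. The coordinates determine these
  distances by a countable infimum, which preserves measurability, and the null set does not depend
  on \<open>y\<close>.\<close>

lemma newtonian_into_dist_measurable:
  fixes h :: "'x::metric_space \<Rightarrow> 'z::metric_space"
  assumes "0 < p" "sets M = sets borel" "h \<in> newtonian_into M p"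
  obtains D where "\<And>y. D y \<in> borel_measurable (completion M)"
    "AE x in completion M. \<forall>y. D y x = dist (h x) y"
proof -
  obtain s v where s: "closure (range s) = UNIV" and v: "v \<in> newtonian M p"
    and vh: "quasieverywhere M p (\<lambda>x. v x = kuratowski s (h x))"
    using assms(3) unfolding newtonian_into_def by blast
  have "(\<lambda>f::linf. apply_bcontfun f n) \<in> borel_measurable borel" for n
  proof (intro borel_measurable_continuous_onI)
    have "1-lipschitz_on UNIV (\<lambda>f::linf. apply_bcontfun f n)"
      by (rule lipschitz_onI) (auto simp: dist_bounded)
    then show "continuous_on UNIV (\<lambda>f::linf. apply_bcontfun f n)"
      by (rule lipschitz_on_continuous_on)
  qed
  moreover have "v \<in> borel_measurable (completion M)" using v by (simp add: newtonian_def)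
  ultimately have [measurable]: "(\<lambda>x. apply_bcontfun (v x) n) \<in> borel_measurable (completion M)" for n
    by (rule measurable_compose[rotated])
  define D where "D y x = (INF n. apply_bcontfun (v x) n + dist (s 0) (s n) + dist (s n) y)" for y x
  have inf: "(INF n. dist z (s n) + dist (s n) y) = dist z y" for z y
  proof (rule antisym)
    have bdd: "bdd_below (range (\<lambda>n. dist z (s n) + dist (s n) y))"
      by (rule bdd_belowI[of _ 0]) auto
    show "(INF n. dist z (s n) + dist (s n) y) \<le> dist z y"
    proof (rule field_le_epsilon)
      fix e :: real assume "0 < e"
      then obtain n where n: "dist (s n) y < e / 2"
        using s closure_approachable[of y "range s"] by (metis UNIV_I half_gt_zero rangeE)
      have "(INF n. dist z (s n) + dist (s n) y) \<le> dist z (s n) + dist (s n) y"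
        by (rule cINF_lower[OF bdd]) simp
      then show "(INF n. dist z (s n) + dist (s n) y) \<le> dist z y + e"
        using n dist_triangle[of z "s n" y] by (simp add: dist_commute)
    qed
    show "dist z y \<le> (INF n. dist z (s n) + dist (s n) y)"
      by (rule cINF_greatest) (auto intro: dist_triangle)
  qed
  show ?thesis
  proof (rule that)
    show "D y \<in> borel_measurable (completion M)" for y
      unfolding D_def by measurable
    show "AE x in completion M. \<forall>y. D y x = dist (h x) y"
      using quasieverywhere_AE[OF assms(1,2) vh]
      by eventually_elim (simp add: D_def apply_kuratowski inf)
  qed
qed

text \<open>Points coincide when their distances to a dense sequence do, so up to a null set
  equality amounts to countably many measurable conditions. The completion absorbs the null
  set.\<close>

lemma newtonian_into_eq_set_measurable:
  fixes h1 h2 :: "'x::metric_space \<Rightarrow> 'z::metric_space"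
  assumes "0 < p" "sets M = sets borel" "h1 \<in> newtonian_into M p" "h2 \<in> newtonian_into M p"
  shows "{x. h1 x = h2 x} \<in> sets (completion M)"
proof -
  have space_M: "space M = UNIV" using sets_eq_imp_space_eq[OF assms(2)] by simp
  obtain s :: "nat \<Rightarrow> 'z" where s: "closure (range s) = UNIV"
    using assms(3) unfolding newtonian_into_def by blast
  obtain D1 where [measurable]: "\<And>y. D1 y \<in> borel_measurable (completion M)"
    and D1: "AE x in completion M. \<forall>y. D1 y x = dist (h1 x) y"
    using newtonian_into_dist_measurable[OF assms(1,2,3)] by blast
  obtain D2 where [measurable]: "\<And>y. D2 y \<in> borel_measurable (completion M)"
    and D2: "AE x in completion M. \<forall>y. D2 y x = dist (h2 x) y"
    using newtonian_into_dist_measurable[OF assms(1,2,4)] by blast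
  let ?A = "{x \<in> space (completion M). \<forall>n. D1 (s n) x = D2 (s n) x}"
  have A: "?A \<in> sets (completion M)" by measurable
  have "AE x in completion M. x \<in> ?A \<longleftrightarrow> x \<in> {x. h1 x = h2 x}"
    using D1 D2
  proof eventually_elim
    case (elim x)
    have "h1 x = h2 x" if eq: "\<And>n. dist (h1 x) (s n) = dist (h2 x) (s n)"
    proof -
      have "dist (h1 x) (h2 x) \<le> 0"
      proof (rule field_le_epsilon)
        fix e :: real assume "0 < e"
        then obtain n where "dist (s n) (h2 x) < e / 2"
          using s closure_approachable[of "h2 x" "range s"] by (metis UNIV_I half_gt_zero rangeE)
        then show "dist (h1 x) (h2 x) \<le> 0 + e"
          using eq[of n] dist_triangle[of "h1 x" "h2 x" "s n"] by (simp add: dist_commute)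
      qed
      then show ?thesis by simp
    qed
    then show ?case using elim by (auto simp: space_M)
  qed
  from completion.in_sets_AE[OF this A] show ?thesis
    by (simp add: space_M)
qed

text \<open>Upper gradients see only distances between values, and these are the same for both
  indicators; a conull set is thereby treated through its null complement.\<close>

lemma upper_gradient_indicator_uminus:
  "upper_gradient g (indicator (- A) :: 'x::metric_space \<Rightarrow> real) \<longleftrightarrow> upper_gradient g (indicator A :: 'x \<Rightarrow> real)"
proof -
  have "dist (indicator (- A) x :: real) (indicator (- A) y) = dist (indicator A x :: real) (indicator A y)" for x y
    by (auto simp: dist_real_def split: split_indicator)
  then show ?thesis by (simp add: upper_gradient_def)
qed

text \<open>The indicator of \<open>A\<close> is admissible for \<open>A\<close> itself. Its
  integral part vanishes, and its gradient part is at most \<open>\<epsilon> powr p\<close> times a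
  fixed finite energy for every \<epsilon> > 0.\<close>

lemma capacity_zero_of_small_upper_gradients:
  fixes M :: "'x::metric_space measure"
  assumes p: "0 < p" and M: "sets M = sets borel" and A: "A \<in> null_sets (completion M)"
    and g: "(\<integral>\<^sup>+ x. epowr (g x) p \<partial>M) < \<infinity>"
    and ug: "\<And>\<epsilon>. 0 < \<epsilon> \<Longrightarrow> upper_gradient (\<lambda>x. ennreal \<epsilon> * g x) (indicator A :: 'x \<Rightarrow> real)"
  shows "capacity M p A = 0"
proof -
  define K where "K = (\<integral>\<^sup>+ x. epowr (g x) p \<partial>M)"
  let ?f = "indicator A :: 'x \<Rightarrow> real"
  have "g \<in> borel_measurable borel" using ug[of 1] by (simp add: upper_gradient_def)
  then have gM [measurable]: "g \<in> borel_measurable M"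
    using measurable_cong_sets[OF M refl, of borel] by auto
  have scale: "(\<integral>\<^sup>+ x. epowr (ennreal \<epsilon> * g x) p \<partial>M) = ennreal (\<epsilon> powr p) * K" if "0 < \<epsilon>" for \<epsilon>
    unfolding K_def by (subst nn_integral_cmult[symmetric]) (auto simp: epowr_cmult that)
  have "(\<integral>\<^sup>+ x. ennreal (norm (?f x) powr p) \<partial>completion M) = (\<integral>\<^sup>+ x. 0 \<partial>completion M)"
    using completion.null_sets_iff_AE[of A M] A
    by (intro nn_integral_cong_AE) (auto elim!: eventually_mono)
  then have int0: "(\<integral>\<^sup>+ x. ennreal (norm (?f x) powr p) \<partial>completion M) = 0" by simp
  have "?f \<in> newtonian M p"
    using int0 ug[of 1] g A unfolding newtonian_def by auto
  then have "capacity M p A \<le> newtonian_norm_pow M p ?f"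
    unfolding capacity_def by (intro INF_lower) auto
  also have "\<dots> = (INF g \<in> {g. upper_gradient g ?f}. \<integral>\<^sup>+ x. epowr (g x) p \<partial>M)"
    by (simp only: newtonian_norm_pow_def int0 add_0)
  finally have le: "capacity M p A \<le> ennreal (\<epsilon> powr p) * K" if "0 < \<epsilon>" for \<epsilon>
    unfolding scale[OF that, symmetric] by (rule order_trans) (intro INF_lower, use ug that in auto)
  obtain k where k: "K = ennreal k" "0 \<le> k" using g unfolding K_def[symmetric] by (cases K) auto
  have "capacity M p A \<le> 0"
  proof (rule ennreal_le_epsilon)
    fix e :: real assume "0 < e"
    \<comment> \<open>Chosen so that \<open>\<epsilon> powr p * k\<close> is at most
      \<open>e\<close>; the summand 1 keeps the denominator positive when
      \<open>k = 0\<close>.\<close>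
    define \<epsilon> where "\<epsilon> = (e / (k + 1)) powr (1 / p)"
    have \<epsilon>: "0 < \<epsilon>" "\<epsilon> powr p = e / (k + 1)"
      using \<open>0 < e\<close> k p by (auto simp: \<epsilon>_def powr_powr)
    have "capacity M p A \<le> ennreal (e / (k + 1)) * ennreal k"
      using le[OF \<epsilon>(1)] unfolding \<epsilon>(2) k(1) .
    also have "\<dots> = ennreal (e / (k + 1) * k)"
      using k \<open>0 < e\<close> by (intro ennreal_mult[symmetric]) auto
    also have "\<dots> \<le> ennreal e"
      using k \<open>0 < e\<close> by (intro ennreal_leI) (simp add: field_simps)
    finally show "capacity M p A \<le> 0 + ennreal e" by simp
  qed
  then show ?thesis by simp
qed

text \<open>The left side of the inequality does not involve the upper gradient, while the right
  side is proportional to \<epsilon>. Hence the mean oscillation of the indicator over the whole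
  space vanishes.\<close>

lemma poincare_dichotomy:
  fixes M :: "'x::metric_space measure"
  assumes p: "1 < p" and X: "compact_doubling_poincare_space M p"
    and A: "A \<in> sets (completion M)" and g: "(\<integral>\<^sup>+ x. epowr (g x) p \<partial>M) < \<infinity>"
    and ug: "\<And>\<epsilon>. 0 < \<epsilon> \<Longrightarrow> upper_gradient (\<lambda>x. ennreal \<epsilon> * g x) (indicator A :: 'x \<Rightarrow> real)"
  shows "A \<in> null_sets (completion M) \<or> - A \<in> null_sets (completion M)"
proof -
  have M: "sets M = sets borel" and cpt: "compact (UNIV :: 'x set)"
    and balls: "\<And>x r. 0 < r \<Longrightarrow> 0 < emeasure M (ball x r) \<and> emeasure M (ball x r) < \<infinity>"
    and poinc: "poincare_inequality M p"
    using X unfolding compact_doubling_poincare_space_def by auto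
  have space_M: "space M = UNIV" using sets_eq_imp_space_eq[OF M] by simp
  \<comment> \<open>Any point can serve as centre, because a bounded space is a ball about each of
    its points.\<close>
  define x0 :: 'x where "x0 = undefined"
  obtain R0 where "\<And>y. dist x0 y \<le> R0"
    using compact_imp_bounded[OF cpt] bounded_any_center[of UNIV x0] by auto
  \<comment> \<open>The added 1 makes the distance bound strict, as open balls require.\<close>
  then have ballU: "ball x0 r = UNIV" if "r \<ge> max 0 R0 + 1" for r
    using that by (force simp: subset_iff intro: le_less_trans)
  define R where "R = max 0 R0 + 1"
  have R: "ball x0 r = UNIV" if "r \<ge> R" for r
    using that ballU by (simp add: R_def)
  have "0 < R" by (simp add: R_def)
  have mU: "0 < emeasure M UNIV" "emeasure M UNIV < \<infinity>"
    using balls[OF \<open>0 < R\<close>, of x0] R[of R] by auto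
  have gM [measurable]: "g \<in> borel_measurable M"
    using ug[of 1] measurable_cong_sets[OF M refl, of borel] by (auto simp: upper_gradient_def)
  define K where "K = (\<integral>\<^sup>+ x. epowr (g x) p \<partial>M)"
  have scale: "(\<integral>\<^sup>+ x. epowr (ennreal \<epsilon> * g x) p \<partial>M) = ennreal (\<epsilon> powr p) * K" if "0 < \<epsilon>" for \<epsilon>
    unfolding K_def by (subst nn_integral_cmult[symmetric]) (auto simp: epowr_cmult that)
  obtain C \<sigma> where C: "1 \<le> C" "1 \<le> \<sigma>" and poinc':
    "\<And>x r u g. 0 < r \<Longrightarrow> locally_integrable M u \<Longrightarrow> upper_gradient g u \<Longrightarrow>
     (\<forall>y. \<exists>s>0. (\<integral>\<^sup>+ w\<in>ball y s. g w \<partial>M) < \<infinity>) \<Longrightarrow>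
     (\<integral>\<^sup>+ y\<in>ball x r. ennreal \<bar>u y - mean_on M (ball x r) u\<bar> \<partial>completion M)
         / emeasure M (ball x r)
       \<le> ennreal (C * r) *
         epowr ((\<integral>\<^sup>+ y\<in>ball x (\<sigma> * r). epowr (g y) p \<partial>M) / emeasure M (ball x (\<sigma> * r))) (1 / p)"
    using poinc unfolding poincare_inequality_def by blast
  let ?f = "indicator A :: 'x \<Rightarrow> real"
  define c where "c = mean_on M UNIV ?f"
  define J where "J = (\<integral>\<^sup>+ y. ennreal \<bar>?f y - c\<bar> \<partial>completion M)"
  have loc_f: "locally_integrable M ?f"
    unfolding locally_integrable_def
  proof (intro allI exI conjI)
    fix x
    have "ball x 1 \<inter> A \<in> sets (completion M)" using A M by (intro sets.Int) auto
    moreover have "emeasure (completion M) (ball x 1 \<inter> A) < \<infinity>"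
    proof -
      have "emeasure (completion M) (ball x 1 \<inter> A) \<le> emeasure (completion M) UNIV"
        using sets.top[of "completion M"] by (intro emeasure_mono) (auto simp: space_M)
      also have "\<dots> = emeasure M UNIV"
        by (subst emeasure_completion) (auto simp: M)
      finally show ?thesis using mU(2) by (rule le_less_trans)
    qed
    ultimately have "integrable (completion M) (indicator (ball x 1 \<inter> A) :: 'x \<Rightarrow> real)"
      by (intro integrable_real_indicator) auto
    then show "set_integrable (completion M) (ball x 1) ?f"
      unfolding set_integrable_def by (simp add: indicator_inter_arith[symmetric])
  qed simp
  have loc_g: "\<forall>y. \<exists>s>0. (\<integral>\<^sup>+ w\<in>ball y s. (ennreal \<epsilon> * g w) \<partial>M) < \<infinity>" if "0 < \<epsilon>" for \<epsilon>
  proof (intro allI exI conjI)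
    fix y
    have "(\<integral>\<^sup>+ w\<in>ball y 1. (ennreal \<epsilon> * g w) \<partial>M) \<le> (\<integral>\<^sup>+ w. 1 + epowr (ennreal \<epsilon> * g w) p \<partial>M)"
      using p by (intro nn_integral_mono) (auto intro: le_one_plus_epowr split: split_indicator)
    also have "\<dots> = emeasure M UNIV + ennreal (\<epsilon> powr p) * K"
      by (subst nn_integral_add) (auto simp: scale[OF that] space_M)
    also have "\<dots> < \<infinity>" using mU g by (simp add: K_def ennreal_mult_less_top)
    finally show "(\<integral>\<^sup>+ w\<in>ball y 1. (ennreal \<epsilon> * g w) \<partial>M) < \<infinity>" .
  qed simp
  \<comment> \<open>This root is finite and fixed before \<epsilon>, so homogeneity makes the
    Poincare bound linear in \<epsilon>.\<close>
  obtain q where q: "epowr (K / emeasure M UNIV) (1 / p) = ennreal q" "0 \<le> q"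
  proof -
    have "K / emeasure M UNIV < \<infinity>"
      using g mU by (auto simp: K_def less_top[symmetric] ennreal_divide_eq_top_iff)
    then have "epowr (K / emeasure M UNIV) (1 / p) \<noteq> top" by (auto simp: epowr_def)
    with that show ?thesis by (cases "epowr (K / emeasure M UNIV) (1 / p)") blast+
  qed
  have bound: "J / emeasure M UNIV \<le> ennreal (C * R * q * \<epsilon>)" if \<epsilon>: "0 < \<epsilon>" for \<epsilon>
  proof -
    \<comment> \<open>Since \<sigma> is at least 1, the dilated ball exhausts the space too, and
      both averages are taken over everything.\<close>
    have \<sigma>R: "ball x0 (\<sigma> * R) = UNIV"
      using C mult_right_mono[of 1 \<sigma> R] \<open>0 < R\<close> by (intro R) simp
    have "J / emeasure M UNIV \<le> ennreal (C * R) *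
        epowr ((\<integral>\<^sup>+ y. epowr (ennreal \<epsilon> * g y) p \<partial>M) / emeasure M UNIV) (1 / p)"
      using poinc'[OF \<open>0 < R\<close> loc_f ug[OF \<epsilon>] loc_g[OF \<epsilon>], of x0]
      by (simp only: R[OF order_refl] \<sigma>R J_def c_def indicator_UNIV mult_1_right)
    also have "epowr ((\<integral>\<^sup>+ y. epowr (ennreal \<epsilon> * g y) p \<partial>M) / emeasure M UNIV) (1 / p)
        = ennreal ((\<epsilon> powr p) powr (1 / p)) * epowr (K / emeasure M UNIV) (1 / p)"
      unfolding scale[OF \<epsilon>] using \<epsilon> by (subst epowr_cmult[symmetric]) (auto simp: ennreal_times_divide)
    also have "\<dots> = ennreal (\<epsilon> * q)"
      using \<epsilon> p q by (simp add: powr_powr ennreal_mult)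
    also have "ennreal (C * R) * \<dots> = ennreal (C * R * q * \<epsilon>)"
      using C \<open>0 < R\<close> \<epsilon> q by (subst ennreal_mult[symmetric]) (auto simp: mult_ac)
    finally show ?thesis .
  qed
  have "J / emeasure M UNIV \<le> 0"
  proof (rule ennreal_le_epsilon)
    fix e :: real assume "0 < e"
    have pos: "0 \<le> C * R * q" using C \<open>0 < R\<close> q by simp
    then have "C * R * q * (e / (C * R * q + 1)) \<le> e"
      using \<open>0 < e\<close> by (simp add: field_simps)
    moreover have "J / emeasure M UNIV \<le> ennreal (C * R * q * (e / (C * R * q + 1)))"
      using pos \<open>0 < e\<close> by (intro bound) simp
    ultimately show "J / emeasure M UNIV \<le> 0 + ennreal e"
      by (metis add_0 ennreal_leI order_trans)
  qed
  then have "J = 0" using mU by (auto simp: ennreal_divide_eq_0_iff)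
  then have "AE y in completion M. ennreal \<bar>?f y - c\<bar> = 0"
    using nn_integral_0_iff_AE[of "\<lambda>y. ennreal \<bar>?f y - c\<bar>" "completion M"] A
    unfolding J_def by simp
  then have ae: "AE y in completion M. ?f y = c" by eventually_elim simp
  show ?thesis
  \<comment> \<open>The constant need not be computed: the indicator is 1 on \<open>A\<close>, so
    any other \<open>c\<close> makes \<open>A\<close> null, while \<open>c = 1\<close> makes the
    complement null.\<close>
  proof (cases "c = 1")
    case True
    have "AE y in completion M. y \<notin> - A" 
      using ae by eventually_elim (use True in \<open>auto split: split_indicator_asm\<close>)
    then show ?thesis by (simp add: completion.null_sets_iff_AE space_M)
  next
    case False
    have "AE y in completion M. y \<notin> A" 
      using ae by eventually_elim (use False in \<open>auto split: split_indicator_asm\<close>)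
    then show ?thesis by (simp add: completion.null_sets_iff_AE space_M)
  qed
qed

text \<open>A maximum commutes with the power, so no convexity constant appears as it would for a
  sum. It still dominates both functions, so a finite line integral of the maximum is inherited by
  each.\<close>

lemma epowr_max_integrable:
  assumes "0 < p" "sets M = sets borel" "f \<in> borel_measurable borel" "g \<in> borel_measurable borel"
    and "(\<integral>\<^sup>+ x. epowr (f x) p \<partial>M) < \<infinity>" "(\<integral>\<^sup>+ x. epowr (g x) p \<partial>M) < \<infinity>"
  shows "(\<integral>\<^sup>+ x. epowr (max (f x) (g x)) p \<partial>M) < \<infinity>"
proof -
  have [measurable]: "f \<in> borel_measurable M" "g \<in> borel_measurable M"
    using assms measurable_cong_sets[OF assms(2) refl, of borel] by auto
  have "(\<integral>\<^sup>+ x. epowr (max (f x) (g x)) p \<partial>M) \<le> (\<integral>\<^sup>+ x. epowr (f x) p + epowr (g x) p \<partial>M)"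
    by (intro nn_integral_mono) (auto simp: epowr_max[OF assms(1)] intro!: max.boundedI)
  also have "\<dots> < \<infinity>" using assms(5,6) by (subst nn_integral_add) auto
  finally show ?thesis .
qed

text \<open>Three requirements on a curve are merged into finiteness of one line integral: finite
  integral of an upper gradient of the representative, agreement of the representative with the
  embedded lift, and the lifting equation, the last two at every point of the curve.\<close>

lemma lift_upper_gradient_data:
  fixes M :: "'x::metric_space measure"
  assumes p: "0 < p" and M: "sets M = sets borel" and h: "is_lift M p \<phi> u h"
  obtains g where "g \<in> borel_measurable borel" "(\<integral>\<^sup>+ x. epowr (g x) p \<partial>M) < \<infinity>"
    "\<And>\<gamma>. \<lbrakk>rectifiable \<gamma>; line_integral \<gamma> g < \<infinity>; 0 < arc_length \<gamma> 1\<rbrakk> \<Longrightarrow>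
      continuous_on {0..1} (h \<circ> \<gamma>) \<and> (\<forall>t\<in>{0..1}. \<phi> (h (\<gamma> t)) = u (\<gamma> t))"
proof -
  obtain s v where s: "closure (range s) = UNIV" and v: "v \<in> newtonian M p"
    and vh: "capacity M p {x. v x \<noteq> kuratowski s (h x)} = 0"
    using h unfolding is_lift_def newtonian_into_def quasieverywhere_def by blast
  have hu: "capacity M p {x. \<phi> (h x) \<noteq> u x} = 0"
    using h unfolding is_lift_def quasieverywhere_def by blast
  obtain g0 where g0: "upper_gradient g0 v" "(\<integral>\<^sup>+ x. epowr (g0 x) p \<partial>M) < \<infinity>"
    using v unfolding newtonian_def by blast
  obtain N1 \<rho>1 where "N1 \<in> null_sets M" "{x. v x \<noteq> kuratowski s (h x)} \<subseteq> N1"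
    and \<rho>1: "\<rho>1 \<in> borel_measurable borel" "(\<integral>\<^sup>+ x. epowr (\<rho>1 x) p \<partial>M) < \<infinity>"
    "\<And>\<gamma> t. \<lbrakk>rectifiable \<gamma>; line_integral \<gamma> \<rho>1 < \<infinity>; 0 < arc_length \<gamma> 1; t \<in> {0..1}\<rbrakk> \<Longrightarrow>
      \<gamma> t \<notin> {x. v x \<noteq> kuratowski s (h x)}"
    by (rule capacity_zero_exceptional[OF p M vh]) (rule that)
  obtain N2 \<rho>2 where "N2 \<in> null_sets M" "{x. \<phi> (h x) \<noteq> u x} \<subseteq> N2"
    and \<rho>2: "\<rho>2 \<in> borel_measurable borel" "(\<integral>\<^sup>+ x. epowr (\<rho>2 x) p \<partial>M) < \<infinity>"
    "\<And>\<gamma> t. \<lbrakk>rectifiable \<gamma>; line_integral \<gamma> \<rho>2 < \<infinity>; 0 < arc_length \<gamma> 1; t \<in> {0..1}\<rbrakk> \<Longrightarrow>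
      \<gamma> t \<notin> {x. \<phi> (h x) \<noteq> u x}"
    by (rule capacity_zero_exceptional[OF p M hu]) (rule that)
  have g0_meas: "g0 \<in> borel_measurable borel" using g0 by (simp add: upper_gradient_def)
  define g where "g x = max (g0 x) (max (\<rho>1 x) (\<rho>2 x))" for x
  show ?thesis
  proof (rule that)
    show "g \<in> borel_measurable borel"
      unfolding g_def using g0_meas \<rho>1 \<rho>2 by measurable
    show "(\<integral>\<^sup>+ x. epowr (g x) p \<partial>M) < \<infinity>"
      unfolding g_def
      by (intro epowr_max_integrable[OF p M] borel_measurable_max g0_meas g0 \<rho>1 \<rho>2)
    fix \<gamma> :: "real \<Rightarrow> 'x"
    assume \<gamma>: "rectifiable \<gamma>" "line_integral \<gamma> g < \<infinity>" "0 < arc_length \<gamma> 1"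
    have "line_integral \<gamma> f < \<infinity>" if "\<And>x. f x \<le> g x" for f
      using line_integral_mono[OF that] \<gamma>(2) by (rule le_less_trans)
    then have fin: "line_integral \<gamma> g0 < \<infinity>" "line_integral \<gamma> \<rho>1 < \<infinity>" "line_integral \<gamma> \<rho>2 < \<infinity>"
      by (simp_all add: g_def max.coboundedI2)
    have "v (\<gamma> t) = kuratowski s (h (\<gamma> t))" "\<phi> (h (\<gamma> t)) = u (\<gamma> t)" if "t \<in> {0..1}" for t
      using \<rho>1(3)[OF \<gamma>(1) fin(2) \<gamma>(3) that] \<rho>2(3)[OF \<gamma>(1) fin(3) \<gamma>(3) that] by simp_all
    then show "continuous_on {0..1} (h \<circ> \<gamma>) \<and> (\<forall>t\<in>{0..1}. \<phi> (h (\<gamma> t)) = u (\<gamma> t))"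
      using newtonian_into_continuous_along[OF \<gamma>(1) s _ g0(1) fin(1)] by blast
  qed
qed

theorem proposition4p4:
  fixes p :: real
    and M :: "'x::metric_space measure"
    and \<phi> :: "'z::metric_space \<Rightarrow> 'y::polish_space"
    and u :: "'x \<Rightarrow> 'y"
    and h1 h2 :: "'x \<Rightarrow> 'z"
  assumes "1 < p"
    and "compact_doubling_poincare_space M p"
    and "length_space TYPE('y)"
    and "length_space TYPE('z)"
    and "connected (UNIV :: 'z set)"
    and "covering_space UNIV \<phi> UNIV"
    and "local_isometry \<phi>"
    and "u \<in> newtonian_into M p"
    and "is_lift M p \<phi> u h1"
    and "is_lift M p \<phi> u h2"
    and "\<exists>E. capacity M p E > 0 \<and> (\<forall>x\<in>E. h1 x = h2 x)"
  shows "quasieverywhere M p (\<lambda>x. h1 x = h2 x)"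
proof -
  have p: "0 < p" using assms(1) by simp
  have M: "sets M = sets borel"
    using assms(2) by (simp add: compact_doubling_poincare_space_def)
  define A where "A = {x. h1 x = h2 x}"
  obtain g1 where g1: "g1 \<in> borel_measurable borel" "(\<integral>\<^sup>+ x. epowr (g1 x) p \<partial>M) < \<infinity>"
    "\<And>\<gamma>. \<lbrakk>rectifiable \<gamma>; line_integral \<gamma> g1 < \<infinity>; 0 < arc_length \<gamma> 1\<rbrakk> \<Longrightarrow>
      continuous_on {0..1} (h1 \<circ> \<gamma>) \<and> (\<forall>t\<in>{0..1}. \<phi> (h1 (\<gamma> t)) = u (\<gamma> t))"
    by (rule lift_upper_gradient_data[OF p M assms(9)]) (rule that)
  obtain g2 where g2: "g2 \<in> borel_measurable borel" "(\<integral>\<^sup>+ x. epowr (g2 x) p \<partial>M) < \<infinity>"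
    "\<And>\<gamma>. \<lbrakk>rectifiable \<gamma>; line_integral \<gamma> g2 < \<infinity>; 0 < arc_length \<gamma> 1\<rbrakk> \<Longrightarrow>
      continuous_on {0..1} (h2 \<circ> \<gamma>) \<and> (\<forall>t\<in>{0..1}. \<phi> (h2 (\<gamma> t)) = u (\<gamma> t))"
    by (rule lift_upper_gradient_data[OF p M assms(10)]) (rule that)
  define g where "g x = max (g1 x) (g2 x)" for x
  have g_meas [measurable]: "g \<in> borel_measurable borel"
    unfolding g_def using g1 g2 by measurable
  have g_int: "(\<integral>\<^sup>+ x. epowr (g x) p \<partial>M) < \<infinity>"
    unfolding g_def by (intro epowr_max_integrable[OF p M] g1 g2)
  have ug: "upper_gradient (\<lambda>x. ennreal \<epsilon> * g x) (indicator A :: 'x \<Rightarrow> real)" if \<epsilon>: "0 < \<epsilon>" for \<epsilon>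
    unfolding upper_gradient_def
  proof (intro conjI allI impI)
    show "(\<lambda>x. ennreal \<epsilon> * g x) \<in> borel_measurable borel" by measurable
    fix \<gamma> :: "real \<Rightarrow> 'x" assume rect: "rectifiable \<gamma>"
    have li: "line_integral \<gamma> (\<lambda>x. ennreal \<epsilon> * g x) = ennreal \<epsilon> * line_integral \<gamma> g"
      by (rule line_integral_cmult[OF rect g_meas])
    \<comment> \<open>Constant curves, exceptional curves, and curves along which both lifts are
      continuous and the lifting equations hold throughout.\<close>
    consider "arc_length \<gamma> 1 \<le> 0" | "line_integral \<gamma> g = \<infinity>" | "0 < arc_length \<gamma> 1" "line_integral \<gamma> g < \<infinity>"
      by (metis infinity_ennreal_def less_top not_le)
    then show "ennreal (dist (indicator A (\<gamma> 0) :: real) (indicator A (\<gamma> 1))) \<le> line_integral \<gamma> (\<lambda>x. ennreal \<epsilon> * g x)"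
    proof cases
      case 1
      then have "dist (\<gamma> 0) (\<gamma> 1) \<le> 0"
        using dist_le_arc_length[OF rect order_refl zero_le_one order_refl] arc_length_0[OF rect] by linarith
      then have "\<gamma> 0 = \<gamma> 1" by simp
      then show ?thesis by simp
    next
      case 2
      \<comment> \<open>An infinite integral stays infinite under any positive factor, so \<epsilon>
        may be arbitrarily small.\<close>
      then show ?thesis using \<epsilon> by (simp add: li ennreal_mult_top)
    next
      case 3
      have "line_integral \<gamma> f < \<infinity>" if "\<And>x. f x \<le> g x" for f
        using line_integral_mono[OF that] 3(2) by (rule le_less_trans)
      then have "line_integral \<gamma> g1 < \<infinity>" "line_integral \<gamma> g2 < \<infinity>"
        by (simp_all add: g_def)
      then have c: "continuous_on {0..1} (h1 \<circ> \<gamma>)" "continuous_on {0..1} (h2 \<circ> \<gamma>)"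
        "\<And>t. t \<in> {0..1} \<Longrightarrow> \<phi> ((h1 \<circ> \<gamma>) t) = \<phi> ((h2 \<circ> \<gamma>) t)"
        using g1(3)[OF rect _ 3(1)] g2(3)[OF rect _ 3(1)] by auto
      \<comment> \<open>Agreement propagates from either endpoint to the other, so the indicator
        does not change along the curve.\<close>
      have "\<gamma> 0 \<in> A \<longleftrightarrow> \<gamma> 1 \<in> A"
        using lift_unique_on_interval[OF assms(7) c, of 0 1] lift_unique_on_interval[OF assms(7) c, of 1 0]
        by (auto simp: A_def)
      then have "indicator A (\<gamma> 0) = (indicator A (\<gamma> 1) :: real)"
        by (simp add: indicator_def)
      then show ?thesis by simp
    qed
  qed
  have h: "h1 \<in> newtonian_into M p" "h2 \<in> newtonian_into M p"
    using assms(9,10) unfolding is_lift_def by blast+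
  have "A \<in> sets (completion M)"
    unfolding A_def by (rule newtonian_into_eq_set_measurable[OF p M h])
  from poincare_dichotomy[OF assms(1,2) this g_int ug]
  have "A \<in> null_sets (completion M) \<or> - A \<in> null_sets (completion M)" .
  then consider "A \<in> null_sets (completion M)" | "- A \<in> null_sets (completion M)"
    by blast
  then show ?thesis
  proof cases
    case 1
    \<comment> \<open>This alternative is impossible: \<open>A\<close> contains a set of positive
      capacity.\<close>
    have "capacity M p A = 0"
      by (rule capacity_zero_of_small_upper_gradients[OF p M 1 g_int ug])
    moreover obtain E where E: "0 < capacity M p E" "\<forall>x\<in>E. h1 x = h2 x" using assms(11) by blast
    moreover have "capacity M p E \<le> capacity M p A"
      using E(2) by (intro capacity_mono) (simp add: A_def subset_iff)
    ultimately show ?thesis by simp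
  next
    case 2
    have "capacity M p (- A) = 0"
    proof (rule capacity_zero_of_small_upper_gradients[OF p M 2 g_int])
      show "upper_gradient (\<lambda>x. ennreal \<epsilon> * g x) (indicator (- A) :: 'x \<Rightarrow> real)" if "0 < \<epsilon>" for \<epsilon>
        unfolding upper_gradient_indicator_uminus using that by (rule ug)
    qed
    moreover have "{x. h1 x \<noteq> h2 x} = - A" by (simp add: A_def Collect_neg_eq)
    ultimately show ?thesis by (simp add: quasieverywhere_def)
  qed
qed

end
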